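(* Let $\mathcal{K}\in\{\mathrm{Fin},\mathrm{Coset},\mathrm{Rat},\mathrm{Alg}\}$ and let $G$ be a finitely presented group. If for every $\phi\in\mathrm{Aut}(G)$ the group $G\rtimes_\phi\mathbb{Z}$ is $\mathcal{K}$-generalized conjugacy separable, then $G$ is $\mathcal{K}$-generalized twisted conjugacy separable and $\mathcal{K}$-generalized Brinkmann conjugacy separable.
   Context: Maps are written on the right. The profinite topology on a group has as basis the cosets of finite index subgroups; a subset is separable if it is closed in this topology. If $G=\langle A\mid R\rangle$ and $\phi\in\mathrm{Aut}(G)$, then $G\rtimes_\phi\mathbb{Z}=\langle A,t\mid R,\ t^{-1}at=a\phi\ (a\in A)\rangle$. Classes of subsets of a finitely generated group $G=\langle A\rangle$ ($A$ finite), with $\widetilde A=A\cup A^{-1}$ and canonical surjective homomorphism $\pi:\widetilde A^*\to G$: $\mathrm{Fin}(G)$ is the class of finite subsets; $\mathrm{Coset}(G)$ the class of cosets of finitely generated subgroups; $\mathrm{Rat}(G)$ (rational subsets) the class of sets $L\pi$ with $L\subseteq\widetilde A^*$ a rational language; $\mathrm{Alg}(G)$ (algebraic subsets) the class of sets $L\pi$ with $L\subseteq\widetilde A^*$ a context-free language. These do not depend on the choice of $A$. A group $G$ is: $\mathcal{K}$-generalized conjugacy separable if $\alpha(K)=\{x^{-1}sx\mid x\in G,\ s\in K\}$ is separable for all $K\in\mathcal{K}(G)$; $\mathcal{K}$-generalized twisted conjugacy separable if $\{(x^{-1}\phi)sx\mid x\in G,\ s\in K\}$ is separable for all $K\in\mathcal{K}(G)$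 and $\phi\in\mathrm{Aut}(G)$; $\mathcal{K}$-generalized Brinkmann conjugacy separable if $\{x^{-1}(s\phi^k)x\mid x\in G,\ s\in K,\ k\in\mathbb{Z}\}$ is separable for all $K\in\mathcal{K}(G)$ and $\phi\in\mathrm{Aut}(G)$. *)

theory Defs
  imports "HOL-Analysis.Abstract_Topology" "HOL-Algebra.Bij" "HOL-Algebra.Generated_Groups"
begin

section \<open>Separable subsets\<close>

text \<open>Right cosets suffice in the next definition, since \<open>g H = (g H g\<^sup>-\<^sup>1) g\<close> and conjugation
  preserves the index.\<close>

definition profinite_topology :: "('a, 'b) monoid_scheme \<Rightarrow> 'a topology" where
  "profinite_topology G =
     topology_generated_by (\<Union>H\<in>{H. subgroup H G \<and> finite (rcosets\<^bsub>G\<^esub> H)}. rcosets\<^bsub>G\<^esub> H)"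

definition separable :: "('a, 'b) monoid_scheme \<Rightarrow> 'a set \<Rightarrow> bool" where
  "separable G S \<longleftrightarrow> closedin (profinite_topology G) S"


section \<open>Group words and presentations\<close>

text \<open>The letter \<open>(x, True)\<close> stands for the generator \<open>x\<close> and \<open>(x, False)\<close> for its formal
  inverse, so that \<^term>\<open>words A\<close> is the free monoid on the alphabet \<open>A \<union> A\<^sup>-\<^sup>1\<close>.\<close>

type_synonym 'x word = "('x \<times> bool) list"

definition words :: "'x set \<Rightarrow> 'x word set" where
  "words A = lists (A \<times> UNIV)"

definition letter_val :: "('a, 'b) monoid_scheme \<Rightarrow> ('x \<Rightarrow> 'a) \<Rightarrow> 'x \<times> bool \<Rightarrow> 'a" where
  "letter_val G f l = (if snd l then f (fst l) else inv\<^bsub>G\<^esub> (f (fst l)))"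

definition word_val :: "('a, 'b) monoid_scheme \<Rightarrow> ('x \<Rightarrow> 'a) \<Rightarrow> 'x word \<Rightarrow> 'a" where
  "word_val G f w = foldr (\<lambda>l g. letter_val G f l \<otimes>\<^bsub>G\<^esub> g) w \<one>\<^bsub>G\<^esub>"

definition word_inv :: "'x word \<Rightarrow> 'x word" where
  "word_inv w = rev (map (\<lambda>(x, b). (x, \<not> b)) w)"

text \<open>Equality of words in the group with generators \<open>A\<close> and relators \<open>R\<close>. A word is
  related to the empty word iff it represents an element of the normal closure of \<open>R\<close> in the
  free group on \<open>A\<close>.\<close>

inductive pres_eq :: "'x set \<Rightarrow> 'x word set \<Rightarrow> 'x word \<Rightarrow> 'x word \<Rightarrow> bool" for A R where
  refl: "w \<in> words A \<Longrightarrow> pres_eq A R w w"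
| sym: "pres_eq A R u v \<Longrightarrow> pres_eq A R v u"
| trans: "pres_eq A R u v \<Longrightarrow> pres_eq A R v w \<Longrightarrow> pres_eq A R u w"
| cancel: "u \<in> words A \<Longrightarrow> v \<in> words A \<Longrightarrow> x \<in> A \<Longrightarrow>
    pres_eq A R (u @ [(x, b), (x, \<not> b)] @ v) (u @ v)"
| relator: "u \<in> words A \<Longrightarrow> v \<in> words A \<Longrightarrow> r \<in> R \<Longrightarrow> pres_eq A R (u @ r @ v) (u @ v)"

text \<open>\<open>G = \<langle>A | R\<rangle>\<close>, the letter \<open>a \<in> A\<close> naming the element \<open>f a\<close> of \<open>G\<close>: the homomorphism from
  the free group on \<open>A\<close> to \<open>G\<close> given by \<open>f\<close> is onto, and its kernel is the normal closure
  of \<open>R\<close>.\<close>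

definition presents :: "('a, 'b) monoid_scheme \<Rightarrow> 'x set \<Rightarrow> 'x word set \<Rightarrow> ('x \<Rightarrow> 'a) \<Rightarrow> bool" where
  "presents G A R f \<longleftrightarrow>
     f \<in> A \<rightarrow> carrier G \<and> R \<subseteq> words A \<and>
     word_val G f ` words A = carrier G \<and>
     (\<forall>w\<in>words A. word_val G f w = \<one>\<^bsub>G\<^esub> \<longleftrightarrow> pres_eq A R w [])"

definition finitely_presented :: "('a, 'b) monoid_scheme \<Rightarrow> bool" where
  "finitely_presented G \<longleftrightarrow>
     (\<exists>(A :: nat set) R f. finite A \<and> finite R \<and> presents G A R f)"


section \<open>Rational and context-free languages\<close>

definition lang_star :: "'l list set \<Rightarrow> 'l list set" where
  "lang_star L = concat ` lists L"

inductive rational_lang :: "'l set \<Rightarrow> 'l list set \<Rightarrow> bool" for \<Sigma> where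
  finite: "finite L \<Longrightarrow> L \<subseteq> lists \<Sigma> \<Longrightarrow> rational_lang \<Sigma> L"
| union: "rational_lang \<Sigma> L \<Longrightarrow> rational_lang \<Sigma> M \<Longrightarrow> rational_lang \<Sigma> (L \<union> M)"
| product: "rational_lang \<Sigma> L \<Longrightarrow> rational_lang \<Sigma> M \<Longrightarrow>
    rational_lang \<Sigma> {u @ v | u v. u \<in> L \<and> v \<in> M}"
| star: "rational_lang \<Sigma> L \<Longrightarrow> rational_lang \<Sigma> (lang_star L)"

text \<open>Context-free grammars: \<open>Inl\<close> marks nonterminals (named by natural numbers), \<open>Inr\<close> marks
  terminals.\<close>

type_synonym 'l productions = "(nat \<times> (nat + 'l) list) set"

definition derives1 :: "'l productions \<Rightarrow> (nat + 'l) list \<Rightarrow> (nat + 'l) list \<Rightarrow> bool" where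
  "derives1 P u v \<longleftrightarrow>
     (\<exists>x N \<alpha> y. (N, \<alpha>) \<in> P \<and> u = x @ [Inl N] @ y \<and> v = x @ \<alpha> @ y)"

definition grammar_lang :: "'l productions \<Rightarrow> nat \<Rightarrow> 'l list set" where
  "grammar_lang P S = {w. (derives1 P)\<^sup>*\<^sup>* [Inl S] (map Inr w)}"

definition context_free_lang :: "'l set \<Rightarrow> 'l list set \<Rightarrow> bool" where
  "context_free_lang \<Sigma> L \<longleftrightarrow>
     (\<exists>P S. finite P \<and> (\<forall>(N, \<alpha>)\<in>P. \<alpha> \<in> lists (UNIV <+> \<Sigma>)) \<and> L = grammar_lang P S)"


section \<open>Classes of subsets of a finitely generated group\<close>

text \<open>The classes of rational and of algebraic subsets do not depend on the choice of the finite
  generating set, which is therefore existentially quantified. Left and right cosets of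
  finitely generated subgroups form the same class.\<close>

definition finite_generating_set :: "('a, 'b) monoid_scheme \<Rightarrow> 'a set \<Rightarrow> bool" where
  "finite_generating_set G A \<longleftrightarrow> finite A \<and> A \<subseteq> carrier G \<and> generate G A = carrier G"

definition fin_subset :: "('a, 'b) monoid_scheme \<Rightarrow> 'a set \<Rightarrow> bool" where
  "fin_subset G K \<longleftrightarrow> finite K \<and> K \<subseteq> carrier G"

definition coset_subset :: "('a, 'b) monoid_scheme \<Rightarrow> 'a set \<Rightarrow> bool" where
  "coset_subset G K \<longleftrightarrow>
     (\<exists>B. finite B \<and> B \<subseteq> carrier G \<and> K \<in> rcosets\<^bsub>G\<^esub> (generate G B))"

definition rational_subset :: "('a, 'b) monoid_scheme \<Rightarrow> 'a set \<Rightarrow> bool" where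
  "rational_subset G K \<longleftrightarrow>
     (\<exists>A L. finite_generating_set G A \<and> rational_lang (A \<times> UNIV) L \<and>
        K = word_val G (\<lambda>a. a) ` L)"

definition algebraic_subset :: "('a, 'b) monoid_scheme \<Rightarrow> 'a set \<Rightarrow> bool" where
  "algebraic_subset G K \<longleftrightarrow>
     (\<exists>A L. finite_generating_set G A \<and> context_free_lang (A \<times> UNIV) L \<and>
        K = word_val G (\<lambda>a. a) ` L)"

datatype subset_class = Fin | Coset | Rat | Alg

fun in_class :: "subset_class \<Rightarrow> ('a, 'b) monoid_scheme \<Rightarrow> 'a set \<Rightarrow> bool" where
  "in_class Fin G K = fin_subset G K"
| "in_class Coset G K = coset_subset G K"
| "in_class Rat G K = rational_subset G K"
| "in_class Alg G K = algebraic_subset G K"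


section \<open>Generalized conjugacy separability\<close>

definition gen_conj_separable :: "subset_class \<Rightarrow> ('a, 'b) monoid_scheme \<Rightarrow> bool" where
  "gen_conj_separable \<K> G \<longleftrightarrow>
     (\<forall>K. in_class \<K> G K \<longrightarrow>
        separable G {inv\<^bsub>G\<^esub> x \<otimes>\<^bsub>G\<^esub> s \<otimes>\<^bsub>G\<^esub> x | x s. x \<in> carrier G \<and> s \<in> K})"

definition gen_twisted_conj_separable :: "subset_class \<Rightarrow> ('a, 'b) monoid_scheme \<Rightarrow> bool" where
  "gen_twisted_conj_separable \<K> G \<longleftrightarrow>
     (\<forall>K. \<forall>\<phi>\<in>auto G. in_class \<K> G K \<longrightarrow>
        separable G {\<phi> (inv\<^bsub>G\<^esub> x) \<otimes>\<^bsub>G\<^esub> s \<otimes>\<^bsub>G\<^esub> x | x s. x \<in> carrier G \<and> s \<in> K})"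

definition gen_Brinkmann_conj_separable :: "subset_class \<Rightarrow> ('a, 'b) monoid_scheme \<Rightarrow> bool" where
  "gen_Brinkmann_conj_separable \<K> G \<longleftrightarrow>
     (\<forall>K. \<forall>\<phi>\<in>auto G. in_class \<K> G K \<longrightarrow>
        separable G {inv\<^bsub>G\<^esub> x \<otimes>\<^bsub>G\<^esub> (\<phi> [^]\<^bsub>AutoGroup G\<^esub> k) s \<otimes>\<^bsub>G\<^esub> x | x s (k :: int).
                       x \<in> carrier G \<and> s \<in> K})"


section \<open>The semidirect product with the integers\<close>

text \<open>The pair \<open>(m, g)\<close> stands for \<open>t\<^sup>m g\<close>; the multiplication is dictated by the relations
  \<open>t\<^sup>-\<^sup>1 g t = \<phi> g\<close>. Theorem \<open>presents_semidirect_int\<close> below shows that this group has the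
  presentation \<open>\<langle>A, t | R, t\<^sup>-\<^sup>1 a t = \<phi> a (a \<in> A)\<rangle>\<close> whenever \<open>G = \<langle>A | R\<rangle>\<close>.\<close>

definition semidirect_int :: "('a, 'b) monoid_scheme \<Rightarrow> ('a \<Rightarrow> 'a) \<Rightarrow> (int \<times> 'a) monoid" where
  "semidirect_int G \<phi> =
     \<lparr>carrier = UNIV \<times> carrier G,
      mult = (\<lambda>(m, g) (n, h). (m + n, (\<phi> [^]\<^bsub>AutoGroup G\<^esub> n) g \<otimes>\<^bsub>G\<^esub> h)),
      one = (0, \<one>\<^bsub>G\<^esub>)\<rparr>"

context
  fixes G :: "('a, 'b) monoid_scheme" and \<phi> :: "'a \<Rightarrow> 'a"
  assumes grp: "group G" and aut: "\<phi> \<in> auto G"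
begin

interpretation G: group G by (rule grp)

lemma auto_pow_mem: "\<phi> [^]\<^bsub>AutoGroup G\<^esub> (n :: int) \<in> auto G"
  using group.int_pow_closed[OF G.AutoGroup, of \<phi> n] aut by (simp add: AutoGroup_def)

lemma auto_pow_hom: "\<phi> [^]\<^bsub>AutoGroup G\<^esub> (n :: int) \<in> hom G G"
  using auto_pow_mem by (simp add: auto_def)

lemma auto_pow_closed:
  "g \<in> carrier G \<Longrightarrow> (\<phi> [^]\<^bsub>AutoGroup G\<^esub> (n :: int)) g \<in> carrier G"
  using auto_pow_hom by (auto simp: hom_def)

lemma auto_pow_mult:
  "g \<in> carrier G \<Longrightarrow> h \<in> carrier G \<Longrightarrow> (\<phi> [^]\<^bsub>AutoGroup G\<^esub> (n :: int)) (g \<otimes>\<^bsub>G\<^esub> h) =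
     (\<phi> [^]\<^bsub>AutoGroup G\<^esub> n) g \<otimes>\<^bsub>G\<^esub> (\<phi> [^]\<^bsub>AutoGroup G\<^esub> n) h"
  using auto_pow_hom by (auto simp: hom_def)

lemma auto_pow_one: "(\<phi> [^]\<^bsub>AutoGroup G\<^esub> (n :: int)) \<one>\<^bsub>G\<^esub> = \<one>\<^bsub>G\<^esub>"
  using auto_pow_hom hom_one[OF _ grp grp] by blast

lemma auto_pow_0: "g \<in> carrier G \<Longrightarrow> (\<phi> [^]\<^bsub>AutoGroup G\<^esub> (0 :: int)) g = g"
  by (simp add: int_pow_def nat_pow_def AutoGroup_def BijGroup_def)

lemma AutoGroup_one: "g \<in> carrier G \<Longrightarrow> \<one>\<^bsub>AutoGroup G\<^esub> g = g"
  by (simp add: AutoGroup_def BijGroup_def)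

lemma auto_pow_1: "(\<phi> [^]\<^bsub>AutoGroup G\<^esub> (1 :: int)) = \<phi>"
  using group.int_pow_1[OF G.AutoGroup] aut by (simp add: AutoGroup_def)

lemma auto_pow_add:
  assumes "g \<in> carrier G"
  shows "(\<phi> [^]\<^bsub>AutoGroup G\<^esub> (m + n :: int)) g =
    (\<phi> [^]\<^bsub>AutoGroup G\<^esub> m) ((\<phi> [^]\<^bsub>AutoGroup G\<^esub> n) g)"
proof -
  have "\<phi> [^]\<^bsub>AutoGroup G\<^esub> (m + n) =
      \<phi> [^]\<^bsub>AutoGroup G\<^esub> m \<otimes>\<^bsub>AutoGroup G\<^esub> \<phi> [^]\<^bsub>AutoGroup G\<^esub> n"
    using group.int_pow_mult[OF G.AutoGroup] aut by (simp add: AutoGroup_def)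
  also have "\<dots> = compose (carrier G) (\<phi> [^]\<^bsub>AutoGroup G\<^esub> m) (\<phi> [^]\<^bsub>AutoGroup G\<^esub> n)"
    using auto_pow_mem[of m] auto_pow_mem[of n]
    by (simp add: AutoGroup_def BijGroup_def auto_def)
  finally show ?thesis
    using assms by (simp add: compose_def)
qed

lemma group_semidirect_int: "group (semidirect_int G \<phi>)"
proof (rule groupI)
  fix x assume "x \<in> carrier (semidirect_int G \<phi>)"
  then obtain m g where x: "x = (m, g)" "g \<in> carrier G"
    by (auto simp: semidirect_int_def)
  let ?y = "(- m, (\<phi> [^]\<^bsub>AutoGroup G\<^esub> (- m)) (inv\<^bsub>G\<^esub> g))"
  have "(\<phi> [^]\<^bsub>AutoGroup G\<^esub> m) ((\<phi> [^]\<^bsub>AutoGroup G\<^esub> (- m)) (inv\<^bsub>G\<^esub> g)) = inv\<^bsub>G\<^esub> g"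
    using auto_pow_add[of "inv\<^bsub>G\<^esub> g" m "- m"] x by (simp add: AutoGroup_one)
  then show "\<exists>y\<in>carrier (semidirect_int G \<phi>).
      y \<otimes>\<^bsub>semidirect_int G \<phi>\<^esub> x = \<one>\<^bsub>semidirect_int G \<phi>\<^esub>"
    using x by (intro bexI[of _ ?y]) (auto simp: semidirect_int_def auto_pow_closed)
qed (auto simp: semidirect_int_def auto_pow_closed auto_pow_mult auto_pow_one AutoGroup_one auto_pow_0
       G.m_assoc add.assoc auto_pow_add[symmetric] add.commute)

end

lemma words_simps [simp]:
  "[] \<in> words A"
  "l # w \<in> words A \<longleftrightarrow> fst l \<in> A \<and> w \<in> words A"
  "u @ v \<in> words A \<longleftrightarrow> u \<in> words A \<and> v \<in> words A"
  by (cases l; auto simp: words_def)+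

lemma word_inv_simps [simp]:
  "word_inv [] = []"
  "word_inv (l # w) = word_inv w @ [(fst l, \<not> snd l)]"
  by (auto simp: word_inv_def split: prod.splits)

lemma word_inv_words [simp]: "w \<in> words A \<Longrightarrow> word_inv w \<in> words A"
  by (induction w) auto

lemma word_val_simps [simp]:
  "word_val G f [] = \<one>\<^bsub>G\<^esub>"
  "word_val G f (l # w) = letter_val G f l \<otimes>\<^bsub>G\<^esub> word_val G f w"
  by (auto simp: word_val_def)

lemma letter_val_closed:
  "group G \<Longrightarrow> f \<in> A \<rightarrow> carrier G \<Longrightarrow> fst l \<in> A \<Longrightarrow> letter_val G f l \<in> carrier G"
  by (auto simp: letter_val_def Pi_iff group.inv_closed)

lemma word_val_closed:
  assumes "group G" "f \<in> A \<rightarrow> carrier G"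
  shows "w \<in> words A \<Longrightarrow> word_val G f w \<in> carrier G"
proof -
  interpret group G by fact
  show "w \<in> words A \<Longrightarrow> word_val G f w \<in> carrier G"
    by (induction w) (auto intro!: letter_val_closed[OF assms])
qed

lemma word_val_append:
  assumes "group G" "f \<in> A \<rightarrow> carrier G"
  shows "u \<in> words A \<Longrightarrow> v \<in> words A \<Longrightarrow>
    word_val G f (u @ v) = word_val G f u \<otimes>\<^bsub>G\<^esub> word_val G f v"
proof -
  interpret group G by fact
  show "u \<in> words A \<Longrightarrow> v \<in> words A \<Longrightarrow>
    word_val G f (u @ v) = word_val G f u \<otimes>\<^bsub>G\<^esub> word_val G f v"
    by (induction u)
      (auto simp: m_assoc letter_val_closed[OF assms] word_val_closed[OF assms])
qed

lemma word_val_inv: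
  assumes "group G" "f \<in> A \<rightarrow> carrier G"
  shows "w \<in> words A \<Longrightarrow> word_val G f (word_inv w) = inv\<^bsub>G\<^esub> word_val G f w"
proof -
  interpret group G by fact
  show "w \<in> words A \<Longrightarrow> word_val G f (word_inv w) = inv\<^bsub>G\<^esub> word_val G f w"
  proof (induction w)
    case (Cons l w)
    then have A: "fst l \<in> A" and w: "w \<in> words A" by auto
    then have fl: "f (fst l) \<in> carrier G" using assms by auto
    have "letter_val G f (fst l, \<not> snd l) = inv\<^bsub>G\<^esub> letter_val G f l"
      using fl by (auto simp: letter_val_def)
    with Cons.IH[OF w] A w show ?case
      using letter_val_closed[OF assms A] word_val_closed[OF assms w]
      by (simp add: word_val_append[OF assms] inv_mult_group)
  qed auto
qed

lemma pres_eq_words: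
  "pres_eq A R u v \<Longrightarrow> R \<subseteq> words A \<Longrightarrow> u \<in> words A \<and> v \<in> words A"
  by (induction rule: pres_eq.induct) auto

lemma pres_eq_sound:
  assumes "group G" "f \<in> A \<rightarrow> carrier G" "R \<subseteq> words A"
    and "\<And>r. r \<in> R \<Longrightarrow> word_val G f r = \<one>\<^bsub>G\<^esub>"
  shows "pres_eq A R u v \<Longrightarrow> word_val G f u = word_val G f v"
proof (induction rule: pres_eq.induct)
  interpret group G by fact
  {
    case (cancel u v x b)
    then have fx: "f x \<in> carrier G" using assms by auto
    have "letter_val G f (x, b) \<otimes>\<^bsub>G\<^esub> (letter_val G f (x, \<not> b) \<otimes>\<^bsub>G\<^esub> g) = g"
      if "g \<in> carrier G" for g
      using fx that by (cases b) (auto simp: letter_val_def m_assoc[symmetric])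
    with cancel show ?case
      using word_val_closed[OF assms(1,2)] by (simp add: word_val_append[OF assms(1,2)])
  next
    case (relator u v r)
    then have "r \<in> words A" using assms by auto
    with relator show ?case
      using word_val_closed[OF assms(1,2)] by (simp add: word_val_append[OF assms(1,2)] assms(4))
  }
qed auto

lemma pres_eq_context:
  assumes "R \<subseteq> words A" "p \<in> words A" "q \<in> words A"
  shows "pres_eq A R u v \<Longrightarrow> pres_eq A R (p @ u @ q) (p @ v @ q)"
proof (induction rule: pres_eq.induct)
  case (refl w)
  then show ?case using assms by (intro pres_eq.refl) auto
next
  case (cancel u v x b)
  then show ?case using pres_eq.cancel[of "p @ u" A "v @ q" x R b] assms by simp
next
  case (relator u v r)
  then show ?case using pres_eq.relator[of "p @ u" A "v @ q" r R] assms by simp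
qed (auto intro: pres_eq.sym pres_eq.trans)

lemma pres_eq_inv_right:
  assumes "R \<subseteq> words A"
  shows "w \<in> words A \<Longrightarrow> pres_eq A R (w @ word_inv w) []"
proof (induction w)
  case (Cons l w)
  then have "pres_eq A R ([l] @ (w @ word_inv w) @ [(fst l, \<not> snd l)])
      ([l] @ [] @ [(fst l, \<not> snd l)])"
    by (intro pres_eq_context assms) auto
  moreover have "pres_eq A R ([] @ [(fst l, snd l), (fst l, \<not> snd l)] @ []) ([] @ [])"
    using Cons by (intro pres_eq.cancel) auto
  ultimately show ?case by (auto intro: pres_eq.trans)
qed (auto intro: pres_eq.refl)

lemma word_inv_word_inv [simp]: "word_inv (word_inv w) = w"
  by (simp add: word_inv_def rev_map case_prod_unfold comp_def)

lemma pres_eq_inv_left: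
  "R \<subseteq> words A \<Longrightarrow> w \<in> words A \<Longrightarrow> pres_eq A R (word_inv w @ w) []"
  using pres_eq_inv_right[of R A "word_inv w"] by simp

lemma presents_pres_eq_iff:
  assumes "group G" "presents G A R f" "u \<in> words A" "v \<in> words A"
  shows "pres_eq A R u v \<longleftrightarrow> word_val G f u = word_val G f v"
proof
  interpret group G by fact
  have f: "f \<in> A \<rightarrow> carrier G" and R: "R \<subseteq> words A"
    and ker: "\<And>w. w \<in> words A \<Longrightarrow> word_val G f w = \<one>\<^bsub>G\<^esub> \<longleftrightarrow> pres_eq A R w []"
    using assms(2) by (auto simp: presents_def)
  {
    assume "pres_eq A R u v"
    moreover have "word_val G f r = \<one>\<^bsub>G\<^esub>" if "r \<in> R" for r
      using ker[of r] R that pres_eq.relator[of "[]" A "[]" r R] by auto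
    ultimately show "word_val G f u = word_val G f v"
      using pres_eq_sound[OF assms(1) f R] by blast
  next
    assume "word_val G f u = word_val G f v"
    then have "word_val G f (u @ word_inv v) = \<one>\<^bsub>G\<^esub>"
      using assms f by (simp add: word_val_append[OF assms(1) f] word_val_inv[OF assms(1) f]
          word_val_closed[OF assms(1) f])
    then have "pres_eq A R (u @ word_inv v) []"
      using ker assms by auto
    from pres_eq_context[OF R _ assms(4) this, of "[]"]
    have 1: "pres_eq A R (u @ word_inv v @ v) v" by simp
    from pres_eq_context[OF R assms(3) _ pres_eq_inv_left[OF R assms(4)], of "[]"]
    have "pres_eq A R (u @ word_inv v @ v) u" by simp
    with 1 show "pres_eq A R u v" by (blast intro: pres_eq.sym pres_eq.trans)
  }
qed

text \<open>In the following, \<open>Some a\<close> is the generator \<open>a \<in> A\<close> and \<open>None\<close> is the stable letter \<open>t\<close>;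
  \<open>c a\<close> is any word in the generators of \<open>G\<close> that represents the image of \<open>a\<close> under \<open>\<phi>\<close>.\<close>

abbreviation lift_word :: "'x word \<Rightarrow> 'x option word" where
  "lift_word \<equiv> map (\<lambda>(x, b). (Some x, b))"

definition semidirect_gens :: "'x set \<Rightarrow> 'x option set" where
  "semidirect_gens A = insert None (Some ` A)"

definition semidirect_rels ::
  "'x set \<Rightarrow> 'x word set \<Rightarrow> ('x \<Rightarrow> 'x word) \<Rightarrow> 'x option word set" where
  "semidirect_rels A R c = lift_word ` R \<union>
     {[(None, False), (Some a, True), (None, True)] @ word_inv (lift_word (c a)) | a. a \<in> A}"

definition semidirect_gen_val ::
  "('a, 'b) monoid_scheme \<Rightarrow> ('x \<Rightarrow> 'a) \<Rightarrow> 'x option \<Rightarrow> int \<times> 'a" where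
  "semidirect_gen_val G f y = (case y of None \<Rightarrow> (1, \<one>\<^bsub>G\<^esub>) | Some a \<Rightarrow> (0, f a))"

lemma lift_word_words [simp]: "lift_word w \<in> words (semidirect_gens A) \<longleftrightarrow> w \<in> words A"
  by (induction w) (auto simp: semidirect_gens_def)

lemma pres_eq_lift:
  "pres_eq A R u v \<Longrightarrow>
     pres_eq (semidirect_gens A) (semidirect_rels A R c) (lift_word u) (lift_word v)"
proof (induction rule: pres_eq.induct)
  case (cancel u v x b)
  then show ?case
    using pres_eq.cancel[of "lift_word u" "semidirect_gens A" "lift_word v" "Some x"]
    by (simp add: semidirect_gens_def[of A, THEN eqset_imp_iff] )
next
  case (relator u v r)
  then show ?case
    using pres_eq.relator[of "lift_word u" "semidirect_gens A" "lift_word v" "lift_word r"]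
    by (auto simp: semidirect_rels_def)
qed (auto intro: pres_eq.intros)

theorem presents_semidirect_int:
  assumes grp: "group G" and aut: "\<phi> \<in> auto G" and pres: "presents G A R f"
    and c: "\<And>a. a \<in> A \<Longrightarrow> c a \<in> words A \<and> word_val G f (c a) = \<phi> (f a)"
  shows "presents (semidirect_int G \<phi>) (semidirect_gens A) (semidirect_rels A R c)
           (semidirect_gen_val G f)"
proof -
  interpret G: group G by (rule grp)
  let ?E = "semidirect_int G \<phi>" and ?A = "semidirect_gens A" and ?R = "semidirect_rels A R c"
    and ?f = "semidirect_gen_val G f"
  interpret E: group ?E by (rule group_semidirect_int[OF grp aut])
  have f: "f \<in> A \<rightarrow> carrier G" and R: "R \<subseteq> words A" and onto: "word_val G f ` words A = carrier G"
    using pres by (auto simp: presents_def)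
  have f': "?f \<in> ?A \<rightarrow> carrier ?E"
    using f by (auto simp: semidirect_gen_val_def semidirect_gens_def semidirect_int_def)
  have R': "?R \<subseteq> words ?A"
    using R c by (auto simp: semidirect_rels_def) (auto simp: semidirect_gens_def)
  have t: "None \<in> ?A" and sA: "Some a \<in> ?A \<longleftrightarrow> a \<in> A" for a
    by (auto simp: semidirect_gens_def)
  have mult: "(m, g) \<otimes>\<^bsub>?E\<^esub> (n, h) = (m + n, (\<phi> [^]\<^bsub>AutoGroup G\<^esub> n) g \<otimes>\<^bsub>G\<^esub> h)" for m n g h
    by (simp add: semidirect_int_def)
  have one: "\<one>\<^bsub>?E\<^esub> = (0, \<one>\<^bsub>G\<^esub>)"
    by (simp add: semidirect_int_def)
  have mem: "(m, g) \<in> carrier ?E \<longleftrightarrow> g \<in> carrier G" for m g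
    by (simp add: semidirect_int_def)
  note pw0 = auto_pow_0[OF grp aut] AutoGroup_one[OF grp aut] and pw1 = auto_pow_1[OF grp aut]
    and pwone = auto_pow_one[OF grp aut]

  have inv0: "inv\<^bsub>?E\<^esub> (0, g) = (0, inv\<^bsub>G\<^esub> g)" if "g \<in> carrier G" for g
    using that by (intro E.inv_equality) (auto simp: mult one mem pw0)
  have invt: "inv\<^bsub>?E\<^esub> (1, \<one>\<^bsub>G\<^esub>) = (- 1, \<one>\<^bsub>G\<^esub>)"
    by (intro E.inv_equality) (auto simp: mult one mem pwone)
  have val_lift: "word_val ?E ?f (lift_word w) = (0, word_val G f w)" if "w \<in> words A" for w
    using that
  proof (induction w)
    case (Cons l w)
    then have "letter_val ?E ?f (Some (fst l), snd l) = (0, letter_val G f l)"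
      using f by (auto simp: letter_val_def semidirect_gen_val_def Pi_iff intro!: inv0)
    with Cons show ?case
      using letter_val_closed[OF grp f, of l] by (simp add: mult case_prod_unfold pw0)
  qed (simp add: one)

  define T :: "int \<Rightarrow> 'c option word"
    where "T n = replicate (nat \<bar>n\<bar>) (None, n \<ge> 0)" for n
  have T_words: "T n \<in> words ?A" for n
    using t by (auto simp: T_def words_def in_lists_conv_set)
  have val_t: "letter_val ?E ?f (None, b) = (if b then 1 else - 1, \<one>\<^bsub>G\<^esub>)" for b
    by (simp add: letter_val_def semidirect_gen_val_def invt)
  have val_rep: "word_val ?E ?f (replicate k (None, b)) = ((if b then 1 else - 1) * int k, \<one>\<^bsub>G\<^esub>)"
    for k b by (induction k) (auto simp: val_t mult one pwone algebra_simps)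
  have val_T: "word_val ?E ?f (T n) = (n, \<one>\<^bsub>G\<^esub>)" for n
    by (simp add: T_def val_rep)
  have val_Tw: "word_val ?E ?f (T n @ lift_word w) = (n, word_val G f w)" if "w \<in> words A" for n w
    using that word_val_closed[OF grp f]
    by (simp add: word_val_append[OF grp[THEN group_semidirect_int[OF _ aut]] f'] T_words
        val_T val_lift mult pw0)

  define eq (infix "\<sim>" 50) where "eq = pres_eq ?A ?R"
  have eq_trans [trans]: "u \<sim> w" if "u \<sim> v" "v \<sim> w" for u v w
    using that pres_eq.trans unfolding eq_def by blast
  have eq_sym: "v \<sim> u" if "u \<sim> v" for u v
    using that pres_eq.sym unfolding eq_def by blast
  have eq_refl: "u \<sim> u" if "u \<in> words ?A" for u
    using that pres_eq.refl unfolding eq_def by blast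
  have ctx: "p @ u @ q \<sim> p @ v @ q" if "u \<sim> v" "p \<in> words ?A" "q \<in> words ?A" for p u q v
    using that pres_eq_context[OF R'] unfolding eq_def by blast
  have canc: "[(x, b), (x, \<not> b)] \<sim> []" if "x \<in> ?A" for x b
    using that pres_eq.cancel[of "[]" ?A "[]" x ?R b] unfolding eq_def by simp
  have inv_l: "word_inv w @ w \<sim> []" and inv_r: "w @ word_inv w \<sim> []" if "w \<in> words ?A" for w
    using that pres_eq_inv_left[OF R'] pres_eq_inv_right[OF R'] unfolding eq_def by auto
  have lift_eq: "lift_word u \<sim> lift_word v"
    if "u \<in> words A" "v \<in> words A" "word_val G f u = word_val G f v" for u v
    using pres_eq_lift presents_pres_eq_iff[OF grp pres] that unfolding eq_def by blast

  have rel: "[(Some a, True), (None, True)] \<sim> (None, True) # lift_word (c a)" if a: "a \<in> A" for a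
  proof -
    let ?w = "lift_word (c a)"
    have w: "?w \<in> words ?A" using c[OF a] by simp
    have "[(None, False), (Some a, True), (None, True)] @ word_inv ?w \<in> ?R"
      using a by (auto simp: semidirect_rels_def)
    from pres_eq.relator[of "[]" ?A "[]", OF _ _ this]
    have r: "[(None, False), (Some a, True), (None, True)] @ word_inv ?w \<sim> []"
      by (simp add: eq_def)
    have "[(Some a, True), (None, True)] \<sim>
        [(None, True), (None, False), (Some a, True), (None, True)] @ word_inv ?w @ ?w"
      using ctx[OF canc[OF t, of True], of "[]" "[(Some a, True), (None, True)]"]
        ctx[OF inv_l[OF w], of "[(None, True), (None, False), (Some a, True), (None, True)]" "[]"]
        t sA a by (auto intro: eq_sym eq_trans)
    also have "\<dots> \<sim> (None, True) # ?w"
      using ctx[OF r, of "[(None, True)]" ?w] t w by simp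
    finally show ?thesis .
  qed
  have rel_inv: "[(Some a, False), (None, True)] \<sim> (None, True) # lift_word (word_inv (c a))"
    if a: "a \<in> A" for a
  proof -
    let ?w = "lift_word (c a)"
    have w: "?w \<in> words ?A" using c[OF a] by simp
    have li: "lift_word (word_inv (c a)) = word_inv ?w"
      by (simp add: word_inv_def rev_map case_prod_unfold comp_def)
    have "[(Some a, False), (None, True)] \<sim> [(Some a, False), (None, True)] @ ?w @ word_inv ?w"
      using ctx[OF inv_r[OF w], of "[(Some a, False), (None, True)]" "[]"] t sA a
      by (auto intro: eq_sym)
    also have "\<dots> \<sim> [(Some a, False), (Some a, True), (None, True)] @ word_inv ?w"
      using ctx[OF eq_sym[OF rel[OF a]], of "[(Some a, False)]" "word_inv ?w"] sA a w by simp
    also have "\<dots> \<sim> (None, True) # word_inv ?w"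
      using ctx[OF canc[of "Some a" False], of "[]" "(None, True) # word_inv ?w"] t sA a w by simp
    finally show ?thesis by (simp add: li)
  qed

  have hom: "\<phi> (g \<otimes>\<^bsub>G\<^esub> h) = \<phi> g \<otimes>\<^bsub>G\<^esub> \<phi> h" if "g \<in> carrier G" "h \<in> carrier G" for g h
    using aut that by (auto simp: auto_def hom_def)
  have phi_inv: "\<phi> (inv\<^bsub>G\<^esub> g) = inv\<^bsub>G\<^esub> \<phi> g" if "g \<in> carrier G" for g
    using aut that group_hom.hom_inv[of G G \<phi>] grp
    by (auto simp: auto_def group_hom_def group_hom_axioms_def)

  have pushp: "\<exists>v\<in>words A. lift_word w @ [(None, True)] \<sim> (None, True) # lift_word v \<and>
      word_val G f v = \<phi> (word_val G f w)" if "w \<in> words A" for w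
    using that
  proof (induction w)
    case Nil
    then show ?case
      using eq_refl[of "[(None, True)]"] t pwone[of 1] by (intro bexI[of _ "[]"]) (auto simp: pw1)
  next
    case (Cons l w)
    obtain a b where l: "l = (a, b)" by (cases l)
    with Cons obtain v where v: "v \<in> words A" "word_val G f v = \<phi> (word_val G f w)"
      "lift_word w @ [(None, True)] \<sim> (None, True) # lift_word v" by auto
    from Cons l have a: "a \<in> A" and w: "w \<in> words A" by auto
    let ?u = "if b then c a else word_inv (c a)"
    have u: "?u \<in> words A" using c[OF a] by auto
    have fa: "f a \<in> carrier G" using f a by auto
    have "lift_word (l # w) @ [(None, True)] \<sim> [(Some a, b), (None, True)] @ lift_word v"
      using ctx[OF v(3), of "[(Some a, b)]" "[]"] a sA l by simp
    also have "\<dots> \<sim> (None, True) # lift_word (?u @ v)"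
      using ctx[of _ _ "[]" "lift_word v"] rel[OF a] rel_inv[OF a] v(1) by (cases b) force+
    finally have 1: "lift_word (l # w) @ [(None, True)] \<sim> (None, True) # lift_word (?u @ v)" .
    have "word_val G f ?u = \<phi> (letter_val G f l)"
      using c[OF a] fa by (auto simp: letter_val_def l phi_inv word_val_inv[OF grp f])
    then have "word_val G f (?u @ v) = \<phi> (word_val G f (l # w))"
      using u v a w l letter_val_closed[OF grp f, of l] word_val_closed[OF grp f w]
      by (simp add: word_val_append[OF grp f] hom)
    with 1 u v(1) show ?case by (intro bexI[of _ "?u @ v"]) auto
  qed

  have pushm: "\<exists>v\<in>words A. lift_word w @ [(None, False)] \<sim> (None, False) # lift_word v"
    if w: "w \<in> words A" for w
  proof -
    have "word_val G f w \<in> \<phi> ` carrier G"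
      using aut word_val_closed[OF grp f w] by (auto simp: auto_def Bij_def bij_betw_def)
    then have "word_val G f w \<in> \<phi> ` word_val G f ` words A"
      by (simp only: onto)
    then obtain v where v: "v \<in> words A" "word_val G f w = \<phi> (word_val G f v)"
      by (elim imageE) simp
    from pushp[OF v(1)] obtain v' where v': "v' \<in> words A"
      "lift_word v @ [(None, True)] \<sim> (None, True) # lift_word v'"
      "word_val G f v' = \<phi> (word_val G f v)"
      by (elim bexE conjE)
    have "lift_word w @ [(None, False)] \<sim> lift_word v' @ [(None, False)]"
      using ctx[OF lift_eq[OF w v'(1)], of "[]" "[(None, False)]"] v v' t by simp
    also have "\<dots> \<sim> [(None, False), (None, True)] @ lift_word v' @ [(None, False)]"
      using ctx[OF canc[OF t, of False], of "[]" "lift_word v' @ [(None, False)]"] v' t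
      by (auto intro: eq_sym)
    also have "\<dots> \<sim> (None, False) # lift_word v @ [(None, True), (None, False)]"
      using ctx[OF eq_sym[OF v'(2)], of "[(None, False)]" "[(None, False)]"] t by simp
    also have "\<dots> \<sim> (None, False) # lift_word v"
      using ctx[OF canc[OF t, of True], of "(None, False) # lift_word v" "[]"] t v(1) by simp
    finally show ?thesis using v(1) by blast
  qed

  have T_snoc: "T n @ [(None, b)] \<sim> T (if b then n + 1 else n - 1)" for n b
  proof (cases "n = 0 \<or> b \<longleftrightarrow> n \<ge> 0")
    case False
    then obtain k where k: "nat \<bar>n\<bar> = Suc k" by (cases "nat \<bar>n\<bar>") auto
    have "T n @ [(None, b)] = replicate k (None, \<not> b) @ [(None, \<not> b), (None, b)]"
      using False by (auto simp: T_def k replicate_append_same simp flip: append_assoc)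
    also have "\<dots> \<sim> replicate k (None, \<not> b)"
      using ctx[OF canc[OF t, of "\<not> b"], of "replicate k (None, \<not> b)" "[]"] t
      by (auto simp: words_def in_lists_conv_set)
    also have "replicate k (None, \<not> b) = T (if b then n + 1 else n - 1)"
    proof -
      have "nat \<bar>if b then n + 1 else n - 1\<bar> = k" using k False by auto
      moreover have "k = 0 \<or> ((if b then n + 1 else n - 1) \<ge> 0 \<longleftrightarrow> \<not> b)" using k False by auto
      ultimately show ?thesis unfolding T_def by auto
    qed
    finally show ?thesis .
  next
    case True
    have "T n @ [(None, b)] = T (if b then n + 1 else n - 1)"
    proof (cases "n = 0")
      case False
      then have "nat \<bar>if b then n + 1 else n - 1\<bar> = Suc (nat \<bar>n\<bar>)" using True by auto
      moreover have "((if b then n + 1 else n - 1) \<ge> 0 \<longleftrightarrow> b)" using True False by auto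
      ultimately show ?thesis using True False
        by (auto simp: T_def replicate_append_same)
    qed (auto simp: T_def)
    then show ?thesis using eq_refl T_words by simp
  qed

  have normal: "\<exists>n. \<exists>w\<in>words A. u \<sim> T n @ lift_word w" if "u \<in> words ?A" for u
    using that
  proof (induction u rule: rev_induct)
    case Nil
    then show ?case
      using eq_refl[of "[]"] by (intro exI[of _ 0] bexI[of _ "[]"]) (auto simp: T_def)
  next
    case (snoc l u)
    then obtain n w where w: "w \<in> words A" "u \<sim> T n @ lift_word w" by auto
    obtain y b where l: "l = (y, b)" by (cases l)
    have lA: "[l] \<in> words ?A" using snoc by simp
    have 1: "u @ [l] \<sim> T n @ lift_word w @ [l]"
      using ctx[OF w(2) _ lA, of "[]"] by simp
    show ?case
    proof (cases y)
      case None
      from w(1) obtain v where v: "v \<in> words A" "lift_word w @ [l] \<sim> l # lift_word v"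
        using pushp[of w] pushm[of w] l None by (cases b) auto
      note 1
      also have "T n @ lift_word w @ [l] \<sim> T n @ [l] @ lift_word v"
        using ctx[OF v(2) T_words, of "[]"] by simp
      also have "\<dots> \<sim> T (if b then n + 1 else n - 1) @ lift_word v"
        using ctx[OF T_snoc, of "[]" "lift_word v"] v(1) l None by simp
      finally show ?thesis using v(1) by blast
    next
      case (Some a)
      then have "a \<in> A" using lA l sA by simp
      then have "w @ [(a, b)] \<in> words A" "u @ [l] \<sim> T n @ lift_word (w @ [(a, b)])"
        using w(1) 1 l Some by auto
      then show ?thesis by blast
    qed
  qed

  have rels: "word_val ?E ?f r = \<one>\<^bsub>?E\<^esub>" if "r \<in> ?R" for r
    using that unfolding semidirect_rels_def
  proof
    assume "r \<in> lift_word ` R"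
    then obtain s where s: "s \<in> R" "r = lift_word s" by auto
    have "pres_eq A R s []" using pres_eq.relator[of "[]" A "[]" s R] s by simp
    then have "word_val G f s = \<one>\<^bsub>G\<^esub>"
      using presents_pres_eq_iff[OF grp pres, of s "[]"] s R by auto
    then show ?thesis using s R val_lift by (auto simp: one)
  next
    assume "r \<in> {[(None, False), (Some a, True), (None, True)] @ word_inv (lift_word (c a)) |a. a \<in> A}"
    then obtain a where a: "a \<in> A"
      and r: "r = [(None, False), (Some a, True), (None, True)] @ word_inv (lift_word (c a))" by auto
    have fa: "f a \<in> carrier G" "\<phi> (f a) \<in> carrier G"
      using f a c[OF a] word_val_closed[OF grp f, of "c a"] by auto
    have "letter_val ?E ?f (Some a, True) = (0, f a)"
      by (simp add: letter_val_def semidirect_gen_val_def)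
    moreover have "word_val ?E ?f (word_inv (lift_word (c a))) = (0, inv\<^bsub>G\<^esub> \<phi> (f a))"
      using c[OF a] fa by (simp add: word_val_inv[OF E.is_group f'] val_lift inv0)
    ultimately show ?thesis
      unfolding r using fa pwone[of 1] by (simp add: val_t mult one pwone pw0 pw1)
  qed

  show ?thesis
    unfolding presents_def
  proof (intro conjI ballI f' R')
    show "word_val ?E ?f ` words ?A = carrier ?E"
    proof
      show "word_val ?E ?f ` words ?A \<subseteq> carrier ?E"
        using word_val_closed[OF E.is_group f'] by auto
      show "carrier ?E \<subseteq> word_val ?E ?f ` words ?A"
      proof
        fix x assume "x \<in> carrier ?E"
        then obtain n w where "w \<in> words A" "x = (n, word_val G f w)"
          using onto by (cases x) (auto simp: mem)
        then have "x = word_val ?E ?f (T n @ lift_word w)" "T n @ lift_word w \<in> words ?A"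
          using val_Tw T_words by auto
        then show "x \<in> word_val ?E ?f ` words ?A" by blast
      qed
    qed
  next
    fix u assume u: "u \<in> words ?A"
    show "word_val ?E ?f u = \<one>\<^bsub>?E\<^esub> \<longleftrightarrow> pres_eq ?A ?R u []"
    proof
      assume "pres_eq ?A ?R u []"
      then show "word_val ?E ?f u = \<one>\<^bsub>?E\<^esub>"
        using pres_eq_sound[OF E.is_group f' R' rels] by fastforce
    next
      assume 1: "word_val ?E ?f u = \<one>\<^bsub>?E\<^esub>"
      from normal[OF u] obtain n w where w: "w \<in> words A" "u \<sim> T n @ lift_word w" by blast
      then have "word_val ?E ?f u = (n, word_val G f w)"
        using pres_eq_sound[OF E.is_group f' R' rels] val_Tw unfolding eq_def by metis
      with 1 have "n = 0" "word_val G f w = \<one>\<^bsub>G\<^esub>" by (auto simp: one)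
      with w have "u \<sim> lift_word w" "lift_word w \<sim> []"
        using lift_eq[of w "[]"] by (auto simp: T_def)
      then show "pres_eq ?A ?R u []" using eq_trans eq_def by blast
    qed
  qed
qed

end

theory Submission
  imports Defs
begin

text \<open>Let \<open>E = G \<rtimes>\<^sub>\<phi> \<int>\<close>, let \<open>K \<subseteq> G\<close>, and write \<open>\<alpha>\<close> for conjugacy closure in \<open>E\<close>. Each of the
  two sets in question is the preimage of a conjugacy closure in \<open>E\<close> under \<open>g \<mapsto> g\<close> or \<open>g \<mapsto> g t\<close>.

  \<^item> Conjugating \<open>s \<in> G\<close> by \<open>t\<^sup>n x\<close> gives \<open>x\<^sup>-\<^sup>1 \<phi>\<^sup>n(s) x\<close>, so the Brinkmann conjugacy closure of
    \<open>K\<close> is \<open>{g \<in> G. g \<in> \<alpha>(K)}\<close>.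
  \<^item> Conjugating \<open>s t = t \<phi>(s)\<close> by \<open>t\<^sup>n x\<close> gives \<open>t h\<close>, where \<open>h = \<phi>(x\<^sup>-\<^sup>1) \<phi>\<^sup>n\<^sup>+\<^sup>1(s) x\<close> is a twisted
    conjugate of \<open>\<phi>\<^sup>n\<^sup>+\<^sup>1(s)\<close>. Every \<open>s\<close> is twisted conjugate to \<open>\<phi>(s) = \<phi>(s) s s\<^sup>-\<^sup>1\<close>, so the
    exponent is immaterial and \<open>t h \<in> \<alpha>(K t)\<close> iff \<open>h\<close> is in the twisted conjugacy closure of
    \<open>K\<close>. That closure contains \<open>g\<close> iff it contains \<open>\<phi>(g)\<close>, and \<open>g t = t \<phi>(g)\<close>; hence it is
    \<open>{g \<in> G. g t \<in> \<alpha>(K t)}\<close>.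

  Both maps from \<open>G\<close> to \<open>E\<close> are a homomorphism followed by a translation. Such a map is continuous for the profinite topologies, hence pulls separable sets back to separable
  sets (\<open>separable_vimage_hom_mult\<close>), and it takes each of the four classes of \<open>G\<close> into the same
  class of \<open>E\<close> (\<open>in_class_hom_image\<close>, \<open>in_class_mult_right\<close>). The presentation of \<open>G\<close> enters
  because it makes \<open>E\<close> finitely generated, so that rational and algebraic subsets of \<open>G\<close> can be
  described by words in generators of \<open>E\<close>.\<close>


section \<open>Continuity in the profinite topology\<close>

lemma topspace_profinite_topology:
  assumes "group G"
  shows "topspace (profinite_topology G) = carrier G"
proof -
  interpret group G by fact
  have "rcosets\<^bsub>G\<^esub> (carrier G) = {carrier G}"
    using coset_join2[OF _ subgroup_self] by (auto simp: RCOSETS_def)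
  then have "carrier G \<in> (\<Union>H\<in>{H. subgroup H G \<and> finite (rcosets\<^bsub>G\<^esub> H)}. rcosets\<^bsub>G\<^esub> H)"
    using subgroup_self by auto
  moreover have "C \<subseteq> carrier G" if "subgroup H G" "C \<in> rcosets\<^bsub>G\<^esub> H" for H C
    using subgroup.rcosets_carrier[OF that(1) is_group that(2)] .
  ultimately show ?thesis
    unfolding profinite_topology_def topology_generated_by_topspace by blast
qed

lemma openin_profinite_rcoset:
  assumes "subgroup H G" "finite (rcosets\<^bsub>G\<^esub> H)" "C \<in> rcosets\<^bsub>G\<^esub> H"
  shows "openin (profinite_topology G) C"
  unfolding profinite_topology_def using assms by (intro topology_generated_by_Basis) auto

text \<open>It is enough to pull back the cosets that generate the topology.\<close>

lemma continuous_map_profiniteI: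
  assumes G: "group G" and E: "group E" and f: "f \<in> carrier G \<rightarrow> carrier E"
    and cosets: "\<And>H C. subgroup H E \<Longrightarrow> finite (rcosets\<^bsub>E\<^esub> H) \<Longrightarrow> C \<in> rcosets\<^bsub>E\<^esub> H \<Longrightarrow>
      openin (profinite_topology G) {g \<in> carrier G. f g \<in> C}"
  shows "continuous_map (profinite_topology G) (profinite_topology E) f"
proof -
  have "f -` C \<inter> topspace (profinite_topology G) = {g \<in> carrier G. f g \<in> C}" for C
    using topspace_profinite_topology[OF G] by auto
  moreover have "f ` topspace (profinite_topology G) \<subseteq> topspace (profinite_topology E)"
    using f by (auto simp: topspace_profinite_topology G E)
  ultimately show ?thesis
    unfolding profinite_topology_def[of E] continuous_on_generated_topo_iff
      topology_generated_by_topspace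
    using cosets by (simp, blast)
qed

text \<open>The preimage of a coset of \<open>H\<close> is empty or a coset of the preimage of \<open>H\<close>. Hence distinct
  cosets of the preimage come from distinct cosets of \<open>H\<close>, and the index stays finite.\<close>

lemma continuous_map_profinite_hom:
  assumes G: "group G" and E: "group E" and hom: "\<theta> \<in> hom G E"
  shows "continuous_map (profinite_topology G) (profinite_topology E) \<theta>"
proof (rule continuous_map_profiniteI[OF G E])
  interpret group_hom G E \<theta>
    using assms by (simp add: group_hom_def group_hom_axioms_def)
  show "\<theta> \<in> carrier G \<rightarrow> carrier E" by auto
  fix H C assume H: "subgroup H E" "finite (rcosets\<^bsub>E\<^esub> H)" and C: "C \<in> rcosets\<^bsub>E\<^esub> H"
  let ?P = "{g \<in> carrier G. \<theta> g \<in> H}"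
  interpret subH: subgroup H E by fact
  have P: "subgroup ?P G"
    by (rule G.subgroupI) (use subH.one_closed in \<open>auto intro: exI[of _ "\<one>\<^bsub>G\<^esub>"]\<close>)
  have coset: "?P #>\<^bsub>G\<^esub> y = {g \<in> carrier G. \<theta> g \<in> H #>\<^bsub>E\<^esub> \<theta> y}" if y: "y \<in> carrier G" for y
  proof (rule Set.set_eqI)
    fix g
    have "g \<in> ?P #>\<^bsub>G\<^esub> y \<longleftrightarrow> g \<in> carrier G \<and> g \<otimes>\<^bsub>G\<^esub> inv\<^bsub>G\<^esub> y \<in> ?P"
      using subgroup.rcos_module[OF P G y, of g] y subgroup.subset[OF P]
        G.r_coset_subset_G[of ?P y] by blast
    also have "\<dots> \<longleftrightarrow> g \<in> carrier G \<and> \<theta> g \<in> H #>\<^bsub>E\<^esub> \<theta> y"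
      using subH.rcos_module[OF E, of "\<theta> y" "\<theta> g"] y by auto
    finally show "g \<in> ?P #>\<^bsub>G\<^esub> y \<longleftrightarrow> g \<in> {g \<in> carrier G. \<theta> g \<in> H #>\<^bsub>E\<^esub> \<theta> y}" by simp
  qed
  have "rcosets\<^bsub>G\<^esub> ?P \<subseteq> (\<lambda>D. {g \<in> carrier G. \<theta> g \<in> D}) ` (rcosets\<^bsub>E\<^esub> H)"
  proof
    fix D assume "D \<in> rcosets\<^bsub>G\<^esub> ?P"
    then obtain y where y: "y \<in> carrier G" "D = ?P #>\<^bsub>G\<^esub> y" by (auto simp: RCOSETS_def)
    show "D \<in> (\<lambda>D. {g \<in> carrier G. \<theta> g \<in> D}) ` (rcosets\<^bsub>E\<^esub> H)"
      unfolding y(2) coset[OF y(1)] using y(1) by (intro imageI) (auto simp: RCOSETS_def)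
  qed
  then have fin: "finite (rcosets\<^bsub>G\<^esub> ?P)"
    using H(2) finite_surj by blast
  show "openin (profinite_topology G) {g \<in> carrier G. \<theta> g \<in> C}"
  proof (cases "\<exists>y\<in>carrier G. \<theta> y \<in> C")
    case True
    then obtain y where y: "y \<in> carrier G" "\<theta> y \<in> C" by blast
    then have "C = H #>\<^bsub>E\<^esub> \<theta> y"
      using C group.repr_independence[OF E _ _ H(1)] by (auto simp: RCOSETS_def)
    then have "{g \<in> carrier G. \<theta> g \<in> C} = ?P #>\<^bsub>G\<^esub> y"
      using coset y(1) by simp
    also have "\<dots> \<in> rcosets\<^bsub>G\<^esub> ?P"
      using y(1) by (auto simp: RCOSETS_def)
    finally show ?thesis using P fin by (intro openin_profinite_rcoset)
  next
    case False
    then have "{g \<in> carrier G. \<theta> g \<in> C} = {}" by blast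
    then show ?thesis by (simp only: openin_empty)
  qed
qed

lemma continuous_map_profinite_mult_right:
  assumes E: "group E" and e: "e \<in> carrier E"
  shows "continuous_map (profinite_topology E) (profinite_topology E) (\<lambda>x. x \<otimes>\<^bsub>E\<^esub> e)"
proof (rule continuous_map_profiniteI[OF E E])
  interpret group E by fact
  show "(\<lambda>x. x \<otimes>\<^bsub>E\<^esub> e) \<in> carrier E \<rightarrow> carrier E" using e by auto
  fix H C assume H: "subgroup H E" "finite (rcosets\<^bsub>E\<^esub> H)" and "C \<in> rcosets\<^bsub>E\<^esub> H"
  then obtain y where y: "y \<in> carrier E" "C = H #>\<^bsub>E\<^esub> y" by (auto simp: RCOSETS_def)
  interpret H: subgroup H E by fact
  let ?y = "y \<otimes>\<^bsub>E\<^esub> inv\<^bsub>E\<^esub> e"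
  have "x \<otimes>\<^bsub>E\<^esub> e \<in> C \<longleftrightarrow> x \<in> H #>\<^bsub>E\<^esub> ?y" if x: "x \<in> carrier E" for x
    using H.rcos_module[OF E, of y "x \<otimes>\<^bsub>E\<^esub> e"] H.rcos_module[OF E, of ?y x] x y e
    by (simp add: inv_mult_group m_assoc)
  then have "{x \<in> carrier E. x \<otimes>\<^bsub>E\<^esub> e \<in> C} = H #>\<^bsub>E\<^esub> ?y"
    using r_coset_subset_G[OF H.subset, of ?y] y e by auto
  moreover have "H #>\<^bsub>E\<^esub> ?y \<in> rcosets\<^bsub>E\<^esub> H"
    using y e by (auto simp: RCOSETS_def)
  ultimately show "openin (profinite_topology E) {x \<in> carrier E. x \<otimes>\<^bsub>E\<^esub> e \<in> C}"
    using H by (simp add: openin_profinite_rcoset)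
qed

lemma separable_vimage_hom_mult:
  assumes G: "group G" and E: "group E" and hom: "\<theta> \<in> hom G E" and e: "e \<in> carrier E"
    and S: "separable E S"
  shows "separable G {g \<in> carrier G. \<theta> g \<otimes>\<^bsub>E\<^esub> e \<in> S}"
proof -
  have "continuous_map (profinite_topology G) (profinite_topology E) (\<lambda>g. \<theta> g \<otimes>\<^bsub>E\<^esub> e)"
    using continuous_map_compose[OF continuous_map_profinite_hom[OF G E hom]
        continuous_map_profinite_mult_right[OF E e]] by (simp add: comp_def)
  from closedin_continuous_map_preimage[OF this] S show ?thesis
    by (simp add: separable_def topspace_profinite_topology[OF G])
qed


section \<open>Operations on rational and context-free languages\<close>

lemma rational_lang_subset_lists:
  "rational_lang \<Sigma> L \<Longrightarrow> L \<subseteq> lists \<Sigma>"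
proof (induction rule: rational_lang.induct)
  case (star L)
  then show ?case by (fastforce simp: lang_star_def in_lists_conv_set)
qed (auto simp: in_lists_conv_set subset_iff)

lemma rational_lang_map:
  assumes h: "h ` \<Sigma> \<subseteq> \<Gamma>"
  shows "rational_lang \<Sigma> L \<Longrightarrow> rational_lang \<Gamma> (map h ` L)"
proof (induction rule: rational_lang.induct)
  case (finite L)
  then show ?case
    using h by (intro rational_lang.finite) (auto simp: in_lists_conv_set subset_iff)
next
  case (union L M)
  then show ?case by (simp add: image_Un rational_lang.union)
next
  case (product L M)
  have "map h ` {u @ v | u v. u \<in> L \<and> v \<in> M} = {u @ v | u v. u \<in> map h ` L \<and> v \<in> map h ` M}"
  proof (intro equalityI subsetI)
    fix w assume "w \<in> map h ` {u @ v | u v. u \<in> L \<and> v \<in> M}"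
    then obtain u v where "u \<in> L" "v \<in> M" "w = map h u @ map h v" by auto
    then show "w \<in> {u @ v | u v. u \<in> map h ` L \<and> v \<in> map h ` M}" by blast
  next
    fix w assume "w \<in> {u @ v | u v. u \<in> map h ` L \<and> v \<in> map h ` M}"
    then obtain u v where "u \<in> L" "v \<in> M" "w = map h (u @ v)" by auto
    then show "w \<in> map h ` {u @ v | u v. u \<in> L \<and> v \<in> M}" by blast
  qed
  with rational_lang.product[OF product.IH] show ?case by simp
next
  case (star L)
  have "map h ` lang_star L = lang_star (map h ` L)"
    by (simp add: lang_star_def lists_image image_image map_concat)
  with rational_lang.star[OF star.IH] show ?case by simp
qed

lemma rational_lang_append_right:
  assumes "rational_lang \<Sigma> L" "v \<in> lists \<Sigma>"
  shows "rational_lang \<Sigma> ((\<lambda>u. u @ v) ` L)"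
proof -
  have "(\<lambda>u. u @ v) ` L = {u @ w | u w. u \<in> L \<and> w \<in> {v}}" by auto
  then show ?thesis
    using rational_lang.product[OF assms(1) rational_lang.finite[of "{v}" \<Sigma>]] assms(2) by simp
qed

definition rename_productions ::
  "(nat \<Rightarrow> nat) \<Rightarrow> ('l \<Rightarrow> 'm) \<Rightarrow> 'l productions \<Rightarrow> 'm productions" where
  "rename_productions r h P = map_prod r (map (map_sum r h)) ` P"

text \<open>As \<open>r\<close> merges no nonterminals, a renamed production applies to a renamed string only where
  the original production applies to the original string. Terminals are never rewritten, so \<open>h\<close>
  may merge them.\<close>

lemma derives1_rename_iff:
  assumes "inj r"
  shows "derives1 (rename_productions r h P) (map (map_sum r h) u) v' \<longleftrightarrow>
    (\<exists>v. v' = map (map_sum r h) v \<and> derives1 P u v)" (is "?L \<longleftrightarrow> ?R")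
proof
  assume ?L
  then obtain x N \<alpha> y where P: "(N, \<alpha>) \<in> P"
    and u: "map (map_sum r h) u = x @ Inl (r N) # y"
    and v': "v' = x @ map (map_sum r h) \<alpha> @ y"
    unfolding derives1_def rename_productions_def by auto
  from u obtain x0 M y0 where u0: "u = x0 @ M # y0" "x = map (map_sum r h) x0"
    "map_sum r h M = Inl (r N)" "y = map (map_sum r h) y0"
    unfolding map_eq_append_conv map_eq_Cons_conv by auto
  from u0(3) have "M = Inl N"
    using assms by (cases M) (auto dest: injD)
  with u0 P v' show ?R
    unfolding derives1_def by (intro exI[of _ "x0 @ \<alpha> @ y0"]) auto
next
  assume ?R
  then obtain x N \<alpha> y where "(N, \<alpha>) \<in> P" "u = x @ [Inl N] @ y"
    "v' = map (map_sum r h) (x @ \<alpha> @ y)"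
    unfolding derives1_def by auto
  then show ?L
    unfolding derives1_def rename_productions_def
    by (intro exI[of _ "map (map_sum r h) x"] exI[of _ "r N"] exI[of _ "map (map_sum r h) \<alpha>"]
        exI[of _ "map (map_sum r h) y"]) force
qed

lemma derives_rename_iff:
  assumes "inj r"
  shows "(derives1 (rename_productions r h P))\<^sup>*\<^sup>* (map (map_sum r h) u) v' \<longleftrightarrow>
    (\<exists>v. v' = map (map_sum r h) v \<and> (derives1 P)\<^sup>*\<^sup>* u v)" (is "?L \<longleftrightarrow> ?R")
proof
  assume ?L
  then show ?R
  proof (induction rule: rtranclp_induct)
    case (step a b)
    then obtain v where v: "a = map (map_sum r h) v" "(derives1 P)\<^sup>*\<^sup>* u v" by blast
    with step.hyps(2) obtain v1 where "b = map (map_sum r h) v1" "derives1 P v v1"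
      using derives1_rename_iff[OF assms] by blast
    with v(2) show ?case by (intro exI[of _ v1]) auto
  qed auto
next
  assume ?R
  then obtain v where v': "v' = map (map_sum r h) v" and "(derives1 P)\<^sup>*\<^sup>* u v" by blast
  from this(2) have "(derives1 (rename_productions r h P))\<^sup>*\<^sup>* (map (map_sum r h) u) (map (map_sum r h) v)"
  proof (induction rule: rtranclp_induct)
    case (step a b)
    then have "derives1 (rename_productions r h P) (map (map_sum r h) a) (map (map_sum r h) b)"
      unfolding derives1_rename_iff[OF assms] by blast
    with step.IH show ?case by (rule rtranclp.rtrancl_into_rtrancl)
  qed simp
  then show ?L unfolding v' .
qed

lemma map_Inr_eq_map_sum_iff:
  "map Inr w = map (map_sum r h) v \<longleftrightarrow> (\<exists>w0. v = map Inr w0 \<and> w = map h w0)"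
proof (induction v arbitrary: w)
  case (Cons a v)
  then show ?case by (cases a; cases w) (auto simp: Cons_eq_map_conv)
qed auto

lemma grammar_lang_rename:
  assumes "inj r"
  shows "grammar_lang (rename_productions r h P) (r S) = map h ` grammar_lang P S"
proof (rule Set.set_eqI)
  fix w
  have "w \<in> grammar_lang (rename_productions r h P) (r S) \<longleftrightarrow>
      (\<exists>v. map Inr w = map (map_sum r h) v \<and> (derives1 P)\<^sup>*\<^sup>* [Inl S] v)"
    using derives_rename_iff[OF assms, of h P "[Inl S]"] by (simp add: grammar_lang_def)
  also have "\<dots> \<longleftrightarrow> w \<in> map h ` grammar_lang P S"
    unfolding map_Inr_eq_map_sum_iff by (auto simp: grammar_lang_def)
  finally show "w \<in> grammar_lang (rename_productions r h P) (r S) \<longleftrightarrow>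
      w \<in> map h ` grammar_lang P S" .
qed

lemma context_free_lang_map:
  assumes h: "h ` \<Sigma> \<subseteq> \<Gamma>" and L: "context_free_lang \<Sigma> L"
  shows "context_free_lang \<Gamma> (map h ` L)"
proof -
  from L obtain P S where P: "finite P" "\<And>N \<alpha>. (N, \<alpha>) \<in> P \<Longrightarrow> \<alpha> \<in> lists (UNIV <+> \<Sigma>)"
    and L: "L = grammar_lang P S"
    unfolding context_free_lang_def by blast
  have "map_sum id h z \<in> UNIV <+> \<Gamma>" if "(N, \<alpha>) \<in> P" "z \<in> set \<alpha>" for N \<alpha> z
    using P(2)[OF that(1)] that(2) h by (fastforce simp: in_lists_conv_set)
  then have "\<forall>(N, \<alpha>)\<in>rename_productions id h P. \<alpha> \<in> lists (UNIV <+> \<Gamma>)"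
    by (auto simp: rename_productions_def)
  moreover have "map h ` L = grammar_lang (rename_productions id h P) S"
    using grammar_lang_rename[of id h P S] L by simp
  moreover have "finite (rename_productions id h P)"
    using P(1) by (simp add: rename_productions_def)
  ultimately show ?thesis
    unfolding context_free_lang_def by blast
qed

lemma context_free_lang_subset_lists:
  assumes "context_free_lang \<Sigma> L"
  shows "L \<subseteq> lists \<Sigma>"
proof
  fix w assume w: "w \<in> L"
  from assms obtain P S where P: "\<And>N \<alpha>. (N, \<alpha>) \<in> P \<Longrightarrow> \<alpha> \<in> lists (UNIV <+> \<Sigma>)"
    and L: "L = grammar_lang P S"
    unfolding context_free_lang_def by blast
  have "set b \<subseteq> UNIV <+> \<Sigma>" if "(derives1 P)\<^sup>*\<^sup>* [Inl S] b" for b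
    using that
  proof (induction rule: rtranclp_induct)
    case (step a b)
    then obtain x N \<alpha> y where "(N, \<alpha>) \<in> P" "a = x @ [Inl N] @ y" "b = x @ \<alpha> @ y"
      unfolding derives1_def by blast
    with step.IH P[of N \<alpha>] show ?case by (auto simp: in_lists_conv_set)
  qed auto
  moreover have "(derives1 P)\<^sup>*\<^sup>* [Inl S] (map Inr w)"
    using w L by (simp add: grammar_lang_def)
  ultimately have "set (map Inr w :: (nat + 'a) list) \<subseteq> UNIV <+> \<Sigma>" .
  then show "w \<in> lists \<Sigma>" by (auto simp: in_lists_conv_set)
qed

text \<open>A new start symbol \<open>0\<close> with the single production \<open>0 \<rightarrow> S v\<close> does it, once the old
  nonterminals have been shifted to make room for \<open>0\<close>.\<close>

lemma context_free_lang_append_right: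
  assumes L: "context_free_lang \<Sigma> L" and v: "v \<in> lists \<Sigma>"
  shows "context_free_lang \<Sigma> ((\<lambda>u. u @ v) ` L)"
proof -
  from L obtain P S where P: "finite P" "\<And>N \<alpha>. (N, \<alpha>) \<in> P \<Longrightarrow> \<alpha> \<in> lists (UNIV <+> \<Sigma>)"
    and L: "L = grammar_lang P S"
    unfolding context_free_lang_def by blast
  let ?Q = "rename_productions Suc (\<lambda>b. b) P"
  let ?start = "Inl (Suc S) # map Inr v"
  let ?Q' = "insert (0, ?start) ?Q"
  have Q: "\<alpha> \<in> lists (UNIV <+> \<Sigma>)" "Inl 0 \<notin> set \<alpha>" "N \<noteq> 0" if "(N, \<alpha>) \<in> ?Q" for N \<alpha>
  proof -
    from that obtain M \<beta> where M: "(M, \<beta>) \<in> P" "N = Suc M" "\<alpha> = map (map_sum Suc (\<lambda>b. b)) \<beta>"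
      by (auto simp: rename_productions_def)
    then show "\<alpha> \<in> lists (UNIV <+> \<Sigma>)" "N \<noteq> 0"
      using P(2)[OF M(1)] by (fastforce simp: in_lists_conv_set)+
    have "Inl 0 \<noteq> map_sum Suc (\<lambda>b. b) x" for x :: "nat + 'a" by (cases x) auto
    then show "Inl 0 \<notin> set \<alpha>" using M(3) by auto
  qed
  have Q'_Q: "derives1 ?Q a b" if "derives1 ?Q' a b" "Inl 0 \<notin> set a" for a b
    using that unfolding derives1_def by fastforce
  have no_0: "Inl 0 \<notin> set b" if "derives1 ?Q a b" "Inl 0 \<notin> set a" for a b
    using that Q(2) unfolding derives1_def by fastforce
  \<comment> \<open>The suffix \<open>v\<close> consists of terminals, so every rewriting step happens to its left.\<close>
  have left: "\<exists>c. b = c @ map Inr v \<and> derives1 ?Q a c" if d: "derives1 ?Q (a @ map Inr v) b" for a b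
  proof -
    from d obtain x N \<alpha> y where \<alpha>: "(N, \<alpha>) \<in> ?Q" and eq: "a @ map Inr v = x @ Inl N # y"
      and b: "b = x @ \<alpha> @ y"
      unfolding derives1_def by auto
    from eq obtain z where "a = x @ Inl N # z" "y = z @ map Inr v"
      by (auto simp: append_eq_append_conv2 append_eq_Cons_conv map_eq_append_conv
          Cons_eq_map_conv Cons_eq_append_conv)
    with \<alpha> b show ?thesis
      unfolding derives1_def by (intro exI[of _ "x @ \<alpha> @ z"]) auto
  qed
  have fwd: "\<exists>c. b = c @ map Inr v \<and> (derives1 ?Q)\<^sup>*\<^sup>* [Inl (Suc S)] c \<and> Inl 0 \<notin> set b"
    if "(derives1 ?Q')\<^sup>*\<^sup>* ?start b" for b
    using that
  proof (induction rule: rtranclp_induct)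
    case base
    then show ?case by (intro exI[of _ "[Inl (Suc S)]"]) auto
  next
    case (step a b)
    then obtain c where c: "a = c @ map Inr v" "(derives1 ?Q)\<^sup>*\<^sup>* [Inl (Suc S)] c" "Inl 0 \<notin> set a"
      by blast
    have ab: "derives1 ?Q a b" using Q'_Q[OF step.hyps(2) c(3)] .
    then obtain c' where "b = c' @ map Inr v" "derives1 ?Q c c'"
      using left c(1) by blast
    with c(2) no_0[OF ab c(3)] show ?case
      by (intro exI[of _ c']) auto
  qed
  have bwd: "(derives1 ?Q')\<^sup>*\<^sup>* ?start (c @ map Inr v)" if "(derives1 ?Q)\<^sup>*\<^sup>* [Inl (Suc S)] c" for c
    using that
  proof (induction rule: rtranclp_induct)
    case (step a b)
    then obtain x N \<alpha> y where "(N, \<alpha>) \<in> ?Q" "a = x @ [Inl N] @ y" "b = x @ \<alpha> @ y"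
      unfolding derives1_def by blast
    then have "derives1 ?Q' (a @ map Inr v) (b @ map Inr v)"
      unfolding derives1_def
      by (intro exI[of _ x] exI[of _ N] exI[of _ \<alpha>] exI[of _ "y @ map Inr v"]) simp
    with step.IH show ?case by (rule rtranclp.rtrancl_into_rtrancl)
  qed simp
  have start: "derives1 ?Q' [Inl 0] b \<longleftrightarrow> b = ?start" for b
    using Q(3) by (auto simp: derives1_def Cons_eq_append_conv)
  have lang_Q: "grammar_lang ?Q (Suc S) = L"
    using grammar_lang_rename[of Suc "\<lambda>b. b" P S] L by simp
  have "grammar_lang ?Q' 0 = (\<lambda>u. u @ v) ` L"
  proof (intro equalityI subsetI)
    fix w assume "w \<in> grammar_lang ?Q' 0"
    then have "(derives1 ?Q')\<^sup>*\<^sup>* [Inl 0] (map Inr w)" by (simp add: grammar_lang_def)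
    then have "(derives1 ?Q')\<^sup>*\<^sup>* ?start (map Inr w)"
      by (cases rule: converse_rtranclpE) (auto simp: start)
    from fwd[OF this] obtain c where c: "map Inr w = c @ map Inr v"
      "(derives1 ?Q)\<^sup>*\<^sup>* [Inl (Suc S)] c" by blast
    then obtain u where "c = map Inr u" "w = u @ v"
      by (auto simp: map_eq_append_conv inj_map_eq_map)
    with c(2) lang_Q show "w \<in> (\<lambda>u. u @ v) ` L" by (auto simp: grammar_lang_def)
  next
    fix w assume "w \<in> (\<lambda>u. u @ v) ` L"
    then obtain u where "w = u @ v" "(derives1 ?Q)\<^sup>*\<^sup>* [Inl (Suc S)] (map Inr u)"
      using lang_Q by (auto simp: grammar_lang_def)
    with bwd[of "map Inr u"] have "(derives1 ?Q')\<^sup>*\<^sup>* ?start (map Inr w)" by simp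
    with start[THEN iffD2, OF HOL.refl] have "(derives1 ?Q')\<^sup>*\<^sup>* [Inl 0] (map Inr w)"
      by (rule converse_rtranclp_into_rtranclp)
    then show "w \<in> grammar_lang ?Q' 0" by (simp add: grammar_lang_def)
  qed
  moreover have "\<forall>(N, \<alpha>)\<in>?Q'. \<alpha> \<in> lists (UNIV <+> \<Sigma>)"
    using Q(1) v by (auto simp: in_lists_conv_set)
  moreover have "finite ?Q'"
    using P(1) by (simp add: rename_productions_def)
  ultimately show ?thesis
    unfolding context_free_lang_def by metis
qed


section \<open>Homomorphic images and translates of the four classes\<close>

lemma generate_image_eq_word_val:
  assumes G: "group G" and f: "f \<in> A \<rightarrow> carrier G"
  shows "generate G (f ` A) = word_val G f ` words A"
proof -
  interpret group G by fact
  have fA: "f ` A \<subseteq> carrier G" using f by auto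
  show ?thesis
  proof (intro equalityI subsetI)
    fix x assume "x \<in> generate G (f ` A)"
    then show "x \<in> word_val G f ` words A"
    proof (induction rule: generate.induct)
      case one
      show ?case by (rule image_eqI[of _ _ "[]"]) auto
    next
      case (incl h)
      then obtain a where "a \<in> A" "h = f a" "f a \<in> carrier G" using f by auto
      then show ?case
        by (intro image_eqI[of _ _ "[(a, True)]"]) (auto simp: letter_val_def)
    next
      case (inv h)
      then obtain a where "a \<in> A" "h = f a" "f a \<in> carrier G" using f by auto
      then show ?case
        by (intro image_eqI[of _ _ "[(a, False)]"]) (auto simp: letter_val_def)
    next
      case (eng h1 h2)
      then obtain u v where "u \<in> words A" "v \<in> words A" "h1 = word_val G f u" "h2 = word_val G f v"
        by auto
      then show ?case
        by (intro image_eqI[of _ _ "u @ v"]) (auto simp: word_val_append[OF G f])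
    qed
  next
    fix x assume "x \<in> word_val G f ` words A"
    then obtain w where w: "w \<in> words A" "x = word_val G f w" by auto
    have "word_val G f w \<in> generate G (f ` A)" using w(1)
    proof (induction w)
      case (Cons l w)
      then have "letter_val G f l \<in> generate G (f ` A)"
        by (auto simp: letter_val_def intro: generate.incl generate.inv)
      with Cons show ?case by (auto intro: generate.eng)
    qed (auto intro: generate.one)
    with w show "x \<in> generate G (f ` A)" by simp
  qed
qed

lemma presents_imp_finite_generating_set:
  assumes "group G" "presents G A R f" "finite A"
  shows "finite_generating_set G (f ` A)"
  using assms generate_image_eq_word_val[of G f A]
  by (auto simp: presents_def finite_generating_set_def)

abbreviation map_letter :: "('x \<Rightarrow> 'y) \<Rightarrow> 'x \<times> bool \<Rightarrow> 'y \<times> bool" where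
  "map_letter \<theta> \<equiv> map_prod \<theta> (\<lambda>b. b)"

lemma word_val_hom_image:
  assumes G: "group G" and E: "group E" and hom: "\<theta> \<in> hom G E" and A: "A \<subseteq> carrier G"
  shows "w \<in> words A \<Longrightarrow>
    word_val E (\<lambda>a. a) (map (map_letter \<theta>) w) = \<theta> (word_val G (\<lambda>a. a) w)"
proof (induction w)
  interpret group_hom G E \<theta>
    using assms by (simp add: group_hom_def group_hom_axioms_def)
  case (Cons l w)
  have id: "(\<lambda>a. a) \<in> A \<rightarrow> carrier G" using A by auto
  have "letter_val E (\<lambda>a. a) (map_letter \<theta> l) = \<theta> (letter_val G (\<lambda>a. a) l)"
    using Cons.prems A by (cases l) (auto simp: letter_val_def subset_iff)
  with Cons letter_val_closed[OF G id, of l] word_val_closed[OF G id, of w]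
  show ?case by simp
qed (use hom_one[OF hom G E] in simp)

text \<open>The images under \<open>\<theta>\<close> of generators of \<open>G\<close> need not generate \<open>E\<close>; a generating set of \<open>E\<close> is
  added to them, and the language is relabelled along \<open>\<theta>\<close>.\<close>

lemma word_language_hom_image:
  assumes G: "group G" and E: "group E" and hom: "\<theta> \<in> hom G E"
    and B: "finite_generating_set E B" and A: "finite_generating_set G A"
    and L: "L \<subseteq> words A"
  obtains C where "finite_generating_set E C" "map_letter \<theta> ` (A \<times> UNIV) \<subseteq> C \<times> UNIV"
    "\<theta> ` word_val G (\<lambda>a. a) ` L = word_val E (\<lambda>a. a) ` map (map_letter \<theta>) ` L"
proof
  interpret E: group E by fact
  have sub: "A \<subseteq> carrier G" "B \<subseteq> carrier E" "\<theta> ` A \<subseteq> carrier E"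
    using A B hom by (auto simp: finite_generating_set_def hom_def)
  have "carrier E \<subseteq> generate E (\<theta> ` A \<union> B)"
    using E.mono_generate[of B "\<theta> ` A \<union> B"] B by (auto simp: finite_generating_set_def)
  then show "finite_generating_set E (\<theta> ` A \<union> B)"
    using A B sub E.generate_incl[of "\<theta> ` A \<union> B"] by (auto simp: finite_generating_set_def)
  show "map_letter \<theta> ` (A \<times> UNIV) \<subseteq> (\<theta> ` A \<union> B) \<times> UNIV" by auto
  show "\<theta> ` word_val G (\<lambda>a. a) ` L = word_val E (\<lambda>a. a) ` map (map_letter \<theta>) ` L"
    unfolding image_image
    using word_val_hom_image[OF G E hom sub(1)] L by (intro image_cong) auto
qed

lemma in_class_subset_carrier:
  assumes "group G" "in_class \<K> G S"
  shows "S \<subseteq> carrier G"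
proof -
  interpret group G by fact
  show ?thesis
  proof (cases \<K>)
    case Fin
    with assms show ?thesis by (simp add: fin_subset_def)
  next
    case Coset
    with assms obtain D where "D \<subseteq> carrier G" "S \<in> rcosets\<^bsub>G\<^esub> (generate G D)"
      by (auto simp: coset_subset_def)
    then show ?thesis
      using subgroup.rcosets_carrier[OF generate_is_subgroup is_group] by blast
  next
    case Rat
    with assms(2) obtain A L where A: "finite_generating_set G A"
      and L: "rational_lang (A \<times> UNIV) L" and S_eq: "S = word_val G (\<lambda>a. a) ` L"
      by (auto simp: rational_subset_def)
    have id: "(\<lambda>a. a) \<in> A \<rightarrow> carrier G"
      using A by (auto simp: finite_generating_set_def)
    have "L \<subseteq> words A" using rational_lang_subset_lists[OF L] by (simp add: words_def)
    then show ?thesis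
      unfolding S_eq using word_val_closed[OF is_group id] by (intro image_subsetI) auto
  next
    case Alg
    with assms(2) obtain A L where A: "finite_generating_set G A"
      and L: "context_free_lang (A \<times> UNIV) L" and S_eq: "S = word_val G (\<lambda>a. a) ` L"
      by (auto simp: algebraic_subset_def)
    have id: "(\<lambda>a. a) \<in> A \<rightarrow> carrier G"
      using A by (auto simp: finite_generating_set_def)
    have "L \<subseteq> words A" using context_free_lang_subset_lists[OF L] by (simp add: words_def)
    then show ?thesis
      unfolding S_eq using word_val_closed[OF is_group id] by (intro image_subsetI) auto
  qed
qed

lemma in_class_hom_image:
  assumes G: "group G" and E: "group E" and hom: "\<theta> \<in> hom G E"
    and B: "finite_generating_set E B" and S: "in_class \<K> G S"
  shows "in_class \<K> E (\<theta> ` S)"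
proof -
  interpret group_hom G E \<theta>
    using assms by (simp add: group_hom_def group_hom_axioms_def)
  show ?thesis
  proof (cases \<K>)
    case Fin
    with S show ?thesis by (auto simp: fin_subset_def)
  next
    case Coset
    with S obtain D y where D: "finite D" "D \<subseteq> carrier G" and y: "y \<in> carrier G"
      and S_eq: "S = generate G D #>\<^bsub>G\<^esub> y"
      by (auto simp: coset_subset_def RCOSETS_def)
    have "\<theta> ` S = (\<lambda>h. \<theta> (h \<otimes>\<^bsub>G\<^esub> y)) ` generate G D"
      unfolding S_eq r_coset_def by blast
    also have "\<dots> = (\<lambda>h. \<theta> h \<otimes>\<^bsub>E\<^esub> \<theta> y) ` generate G D"
      using G.generate_in_carrier[OF D(2)] y by (intro image_cong) auto
    also have "\<dots> = \<theta> ` generate G D #>\<^bsub>E\<^esub> \<theta> y"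
      unfolding r_coset_def by blast
    also have "\<dots> = generate E (\<theta> ` D) #>\<^bsub>E\<^esub> \<theta> y"
      using generate_img[OF D(2)] by simp
    finally have "\<theta> ` S \<in> rcosets\<^bsub>E\<^esub> (generate E (\<theta> ` D))"
      using y by (auto simp: RCOSETS_def)
    moreover have "finite (\<theta> ` D)" "\<theta> ` D \<subseteq> carrier E" using D by auto
    ultimately show ?thesis using Coset by (auto simp: coset_subset_def)
  next
    case Rat
    with S obtain A L where A: "finite_generating_set G A" and L: "rational_lang (A \<times> UNIV) L"
      and S_eq: "S = word_val G (\<lambda>a. a) ` L"
      by (auto simp: rational_subset_def)
    have "L \<subseteq> words A" using rational_lang_subset_lists[OF L] by (simp add: words_def)
    from word_language_hom_image[OF G E hom B A this] obtain C
      where C: "finite_generating_set E C" "map_letter \<theta> ` (A \<times> UNIV) \<subseteq> C \<times> UNIV"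
        "\<theta> ` S = word_val E (\<lambda>a. a) ` map (map_letter \<theta>) ` L"
      unfolding S_eq by blast
    have "rational_subset E (\<theta> ` S)"
      unfolding rational_subset_def
      by (rule exI[of _ C], rule exI[of _ "map (map_letter \<theta>) ` L"])
        (intro conjI C rational_lang_map[OF C(2) L])
    with Rat show ?thesis by simp
  next
    case Alg
    with S obtain A L where A: "finite_generating_set G A" and L: "context_free_lang (A \<times> UNIV) L"
      and S_eq: "S = word_val G (\<lambda>a. a) ` L"
      by (auto simp: algebraic_subset_def)
    have "L \<subseteq> words A" using context_free_lang_subset_lists[OF L] by (simp add: words_def)
    from word_language_hom_image[OF G E hom B A this] obtain C
      where C: "finite_generating_set E C" "map_letter \<theta> ` (A \<times> UNIV) \<subseteq> C \<times> UNIV"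
        "\<theta> ` S = word_val E (\<lambda>a. a) ` map (map_letter \<theta>) ` L"
      unfolding S_eq by blast
    have "algebraic_subset E (\<theta> ` S)"
      unfolding algebraic_subset_def
      by (rule exI[of _ C], rule exI[of _ "map (map_letter \<theta>) ` L"])
        (intro conjI C context_free_lang_map[OF C(2) L])
    with Alg show ?thesis by simp
  qed
qed

lemma word_language_mult_right:
  assumes E: "group E" and A: "finite_generating_set E A" and e: "e \<in> carrier E"
    and L: "L \<subseteq> words A"
  obtains v where "v \<in> words A"
    "(\<lambda>x. x \<otimes>\<^bsub>E\<^esub> e) ` word_val E (\<lambda>a. a) ` L = word_val E (\<lambda>a. a) ` (\<lambda>u. u @ v) ` L"
proof -
  have id: "(\<lambda>a. a) \<in> A \<rightarrow> carrier E"
    using A by (auto simp: finite_generating_set_def)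
  have "e \<in> word_val E (\<lambda>a. a) ` words A"
    using generate_image_eq_word_val[OF E id] A e by (simp add: finite_generating_set_def)
  then obtain v where v: "v \<in> words A" "e = word_val E (\<lambda>a. a) v" by auto
  have "(\<lambda>x. x \<otimes>\<^bsub>E\<^esub> e) ` word_val E (\<lambda>a. a) ` L = word_val E (\<lambda>a. a) ` (\<lambda>u. u @ v) ` L"
    unfolding image_image v(2)
    using word_val_append[OF E id _ v(1)] L by (intro image_cong) auto
  with v(1) that show thesis by blast
qed

lemma in_class_mult_right:
  assumes E: "group E" and e: "e \<in> carrier E" and S: "in_class \<K> E S"
  shows "in_class \<K> E ((\<lambda>x. x \<otimes>\<^bsub>E\<^esub> e) ` S)"
proof -
  interpret group E by fact
  show ?thesis
  proof (cases \<K>)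
    case Fin
    with S e show ?thesis by (auto simp: fin_subset_def)
  next
    case Coset
    with S obtain D y where D: "finite D" "D \<subseteq> carrier E" and y: "y \<in> carrier E"
      and S_eq: "S = generate E D #>\<^bsub>E\<^esub> y"
      by (auto simp: coset_subset_def RCOSETS_def)
    have "(\<lambda>x. x \<otimes>\<^bsub>E\<^esub> e) ` S = S #>\<^bsub>E\<^esub> e" by (auto simp: r_coset_def)
    also have "\<dots> = generate E D #>\<^bsub>E\<^esub> (y \<otimes>\<^bsub>E\<^esub> e)"
      unfolding S_eq using generate_incl[OF D(2)] y e by (rule coset_mult_assoc)
    also have "\<dots> \<in> rcosets\<^bsub>E\<^esub> (generate E D)"
      using y e by (auto simp: RCOSETS_def)
    finally show ?thesis using Coset D by (auto simp: coset_subset_def)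
  next
    case Rat
    with S obtain A L where A: "finite_generating_set E A" and L: "rational_lang (A \<times> UNIV) L"
      and S_eq: "S = word_val E (\<lambda>a. a) ` L"
      by (auto simp: rational_subset_def)
    have "L \<subseteq> words A" using rational_lang_subset_lists[OF L] by (simp add: words_def)
    then obtain v where "v \<in> words A"
      "(\<lambda>x. x \<otimes>\<^bsub>E\<^esub> e) ` S = word_val E (\<lambda>a. a) ` (\<lambda>u. u @ v) ` L"
      using word_language_mult_right[OF E A e] S_eq by metis
    with A rational_lang_append_right[OF L, of v] Rat show ?thesis
      by (auto simp: rational_subset_def words_def)
  next
    case Alg
    with S obtain A L where A: "finite_generating_set E A" and L: "context_free_lang (A \<times> UNIV) L"
      and S_eq: "S = word_val E (\<lambda>a. a) ` L"
      by (auto simp: algebraic_subset_def)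
    have "L \<subseteq> words A" using context_free_lang_subset_lists[OF L] by (simp add: words_def)
    then obtain v where "v \<in> words A"
      "(\<lambda>x. x \<otimes>\<^bsub>E\<^esub> e) ` S = word_val E (\<lambda>a. a) ` (\<lambda>u. u @ v) ` L"
      using word_language_mult_right[OF E A e] S_eq by metis
    with A context_free_lang_append_right[OF L, of v] Alg show ?thesis
      by (auto simp: algebraic_subset_def words_def)
  qed
qed


section \<open>Conjugacy in the semidirect product\<close>

context
  fixes G :: "('a, 'b) monoid_scheme" and \<phi> :: "'a \<Rightarrow> 'a"
  assumes grp: "group G" and aut: "\<phi> \<in> auto G"
begin

interpretation G: group G by (rule grp)

interpretation E: group "semidirect_int G \<phi>" by (rule group_semidirect_int[OF grp aut])

abbreviation auto_pow :: "int \<Rightarrow> 'a \<Rightarrow> 'a" where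
  "auto_pow n \<equiv> \<phi> [^]\<^bsub>AutoGroup G\<^esub> n"

lemmas pow_closed = auto_pow_closed[OF grp aut] and pow_mult = auto_pow_mult[OF grp aut]
  and pow_one = auto_pow_one[OF grp aut] and pow_add = auto_pow_add[OF grp aut]
  and pow_0 = auto_pow_0[OF grp aut] AutoGroup_one[OF grp aut] and pow_1 = auto_pow_1[OF grp aut]

lemma carrier_semidirect: "(m, g) \<in> carrier (semidirect_int G \<phi>) \<longleftrightarrow> g \<in> carrier G"
  by (simp add: semidirect_int_def)

lemma mult_semidirect:
  "(m, g) \<otimes>\<^bsub>semidirect_int G \<phi>\<^esub> (n, h) = (m + n, auto_pow n g \<otimes>\<^bsub>G\<^esub> h)"
  by (simp add: semidirect_int_def)

lemma inv_semidirect: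
  assumes "x \<in> carrier G"
  shows "inv\<^bsub>semidirect_int G \<phi>\<^esub> (n, x) = (- n, auto_pow (- n) (inv\<^bsub>G\<^esub> x))"
proof (rule E.inv_equality)
  show "(- n, auto_pow (- n) (inv\<^bsub>G\<^esub> x)) \<otimes>\<^bsub>semidirect_int G \<phi>\<^esub> (n, x) = \<one>\<^bsub>semidirect_int G \<phi>\<^esub>"
    using assms pow_add[of "inv\<^bsub>G\<^esub> x" n "- n"]
    by (simp add: mult_semidirect pow_0 semidirect_int_def)
qed (use assms in \<open>simp_all add: carrier_semidirect pow_closed\<close>)

lemma conj_semidirect:
  assumes "x \<in> carrier G" "g \<in> carrier G"
  shows "inv\<^bsub>semidirect_int G \<phi>\<^esub> (n, x) \<otimes>\<^bsub>semidirect_int G \<phi>\<^esub> (m, g) \<otimes>\<^bsub>semidirect_int G \<phi>\<^esub> (n, x)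
    = (m, auto_pow m (inv\<^bsub>G\<^esub> x) \<otimes>\<^bsub>G\<^esub> auto_pow n g \<otimes>\<^bsub>G\<^esub> x)"
proof -
  have "auto_pow n (auto_pow m (auto_pow (- n) (inv\<^bsub>G\<^esub> x))) = auto_pow m (inv\<^bsub>G\<^esub> x)"
    using assms pow_add[of "inv\<^bsub>G\<^esub> x" "n + m" "- n"] pow_add[of "auto_pow (- n) (inv\<^bsub>G\<^esub> x)" n m]
    by (simp add: pow_closed)
  then show ?thesis
    using assms by (simp add: inv_semidirect mult_semidirect pow_closed pow_mult)
qed

lemma embed_semidirect_hom: "Pair 0 \<in> hom G (semidirect_int G \<phi>)"
  by (auto simp: hom_def carrier_semidirect mult_semidirect pow_0)

lemma phi_closed: "g \<in> carrier G \<Longrightarrow> \<phi> g \<in> carrier G"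
  using pow_closed[of g 1] by (simp add: pow_1)

lemma phi_mult: "g \<in> carrier G \<Longrightarrow> h \<in> carrier G \<Longrightarrow> \<phi> (g \<otimes>\<^bsub>G\<^esub> h) = \<phi> g \<otimes>\<^bsub>G\<^esub> \<phi> h"
  using pow_mult[of g h 1] by (simp add: pow_1)

lemma phi_inj: "g \<in> carrier G \<Longrightarrow> h \<in> carrier G \<Longrightarrow> \<phi> g = \<phi> h \<Longrightarrow> g = h"
  using aut by (auto simp: auto_def Bij_def bij_betw_def dest: inj_onD)

lemma phi_inv: "g \<in> carrier G \<Longrightarrow> \<phi> (inv\<^bsub>G\<^esub> g) = inv\<^bsub>G\<^esub> (\<phi> g)"
  using phi_mult[of "inv\<^bsub>G\<^esub> g" g] pow_one[of 1] phi_closed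
  by (intro G.inv_equality[symmetric]) (auto simp: pow_1)

text \<open>Twisted conjugacy by \<open>r\<^sup>-\<^sup>1\<close> takes \<open>r\<close> to \<open>\<phi> r\<close>; iterate this along the orbit of \<open>s\<close>, in both
  directions.\<close>

lemma auto_pow_twisted_conj:
  assumes s: "s \<in> carrier G"
  shows "\<exists>z\<in>carrier G. auto_pow n s = \<phi> (inv\<^bsub>G\<^esub> z) \<otimes>\<^bsub>G\<^esub> s \<otimes>\<^bsub>G\<^esub> z"
proof (induction n rule: int_induct[where k = 0])
  case base
  show ?case
    using s pow_one[of 1] by (intro bexI[of _ "\<one>\<^bsub>G\<^esub>"]) (auto simp: pow_0 pow_1)
next
  case (step1 n)
  then obtain z where z: "z \<in> carrier G"
    "auto_pow n s = \<phi> (inv\<^bsub>G\<^esub> z) \<otimes>\<^bsub>G\<^esub> s \<otimes>\<^bsub>G\<^esub> z" by blast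
  let ?r = "auto_pow n s"
  have r: "?r \<in> carrier G" "\<phi> ?r \<in> carrier G" using s by (auto simp: pow_closed phi_closed)
  have "auto_pow (n + 1) s = \<phi> ?r \<otimes>\<^bsub>G\<^esub> ?r \<otimes>\<^bsub>G\<^esub> inv\<^bsub>G\<^esub> ?r"
    using pow_add[OF s, of 1 n] r by (simp add: pow_1 G.m_assoc add.commute)
  also have "\<dots> = \<phi> ?r \<otimes>\<^bsub>G\<^esub> (\<phi> (inv\<^bsub>G\<^esub> z) \<otimes>\<^bsub>G\<^esub> s \<otimes>\<^bsub>G\<^esub> z) \<otimes>\<^bsub>G\<^esub> inv\<^bsub>G\<^esub> ?r"
    using z(2) by simp
  also have "\<dots> = \<phi> (inv\<^bsub>G\<^esub> (z \<otimes>\<^bsub>G\<^esub> inv\<^bsub>G\<^esub> ?r)) \<otimes>\<^bsub>G\<^esub> s \<otimes>\<^bsub>G\<^esub> (z \<otimes>\<^bsub>G\<^esub> inv\<^bsub>G\<^esub> ?r)"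
    using r(1) z(1) s by (simp add: G.inv_mult_group phi_mult phi_closed G.m_assoc)
  finally show ?case using r(1) z(1) by (intro bexI[of _ "z \<otimes>\<^bsub>G\<^esub> inv\<^bsub>G\<^esub> ?r"]) auto
next
  case (step2 n)
  then obtain z where z: "z \<in> carrier G"
    "auto_pow n s = \<phi> (inv\<^bsub>G\<^esub> z) \<otimes>\<^bsub>G\<^esub> s \<otimes>\<^bsub>G\<^esub> z" by blast
  let ?r = "auto_pow (n - 1) s"
  have r: "?r \<in> carrier G" "\<phi> ?r \<in> carrier G" using s by (auto simp: pow_closed phi_closed)
  have \<phi>r: "\<phi> ?r = \<phi> (inv\<^bsub>G\<^esub> z) \<otimes>\<^bsub>G\<^esub> s \<otimes>\<^bsub>G\<^esub> z"
    using pow_add[OF s, of 1 "n - 1"] z(2) by (simp add: pow_1)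
  have "?r = \<phi> (inv\<^bsub>G\<^esub> ?r) \<otimes>\<^bsub>G\<^esub> \<phi> ?r \<otimes>\<^bsub>G\<^esub> ?r"
    using r by (simp add: phi_inv)
  also have "\<dots> = \<phi> (inv\<^bsub>G\<^esub> ?r) \<otimes>\<^bsub>G\<^esub> (\<phi> (inv\<^bsub>G\<^esub> z) \<otimes>\<^bsub>G\<^esub> s \<otimes>\<^bsub>G\<^esub> z) \<otimes>\<^bsub>G\<^esub> ?r"
    unfolding \<phi>r ..
  also have "\<dots> = \<phi> (inv\<^bsub>G\<^esub> (z \<otimes>\<^bsub>G\<^esub> ?r)) \<otimes>\<^bsub>G\<^esub> s \<otimes>\<^bsub>G\<^esub> (z \<otimes>\<^bsub>G\<^esub> ?r)"
    using r(1) z(1) s by (simp add: G.inv_mult_group phi_mult phi_closed G.m_assoc)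
  finally show ?case using r(1) z(1) by (intro bexI[of _ "z \<otimes>\<^bsub>G\<^esub> ?r"]) auto
qed

lemma Brinkmann_closure_eq_vimage:
  assumes K: "K \<subseteq> carrier G"
  shows "{inv\<^bsub>G\<^esub> x \<otimes>\<^bsub>G\<^esub> auto_pow k s \<otimes>\<^bsub>G\<^esub> x | x s k. x \<in> carrier G \<and> s \<in> K} =
    {g \<in> carrier G. (0, g) \<in> {inv\<^bsub>semidirect_int G \<phi>\<^esub> y \<otimes>\<^bsub>semidirect_int G \<phi>\<^esub> s
        \<otimes>\<^bsub>semidirect_int G \<phi>\<^esub> y | y s. y \<in> carrier (semidirect_int G \<phi>) \<and> s \<in> Pair 0 ` K}}"
    (is "?L = ?R")
proof (intro equalityI subsetI)
  fix g assume "g \<in> ?L"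
  then obtain x s k where x: "x \<in> carrier G" and s: "s \<in> K"
    and g: "g = inv\<^bsub>G\<^esub> x \<otimes>\<^bsub>G\<^esub> auto_pow k s \<otimes>\<^bsub>G\<^esub> x" by blast
  have sG: "s \<in> carrier G" using s K by auto
  have "(0, g) = inv\<^bsub>semidirect_int G \<phi>\<^esub> (k, x) \<otimes>\<^bsub>semidirect_int G \<phi>\<^esub> (0, s)
      \<otimes>\<^bsub>semidirect_int G \<phi>\<^esub> (k, x)"
    using x sG by (simp add: g conj_semidirect pow_0)
  moreover have "(k, x) \<in> carrier (semidirect_int G \<phi>)" "g \<in> carrier G"
    using x sG by (simp_all add: g carrier_semidirect pow_closed)
  ultimately show "g \<in> ?R" using s by blast
next
  fix g assume "g \<in> ?R"
  then obtain k x s where x: "x \<in> carrier G" and s: "s \<in> K"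
    and "(0, g) = inv\<^bsub>semidirect_int G \<phi>\<^esub> (k, x) \<otimes>\<^bsub>semidirect_int G \<phi>\<^esub> (0, s)
      \<otimes>\<^bsub>semidirect_int G \<phi>\<^esub> (k, x)"
    by (auto simp: carrier_semidirect)
  then have "g = inv\<^bsub>G\<^esub> x \<otimes>\<^bsub>G\<^esub> auto_pow k s \<otimes>\<^bsub>G\<^esub> x"
    using K by (simp add: conj_semidirect subset_iff pow_0)
  with x s show "g \<in> ?L" by blast
qed

text \<open>Since \<open>g t = t \<phi>(g)\<close>, a conjugate of \<open>s t\<close> that has the form \<open>g t\<close> yields an equation for
  \<open>\<phi> g\<close>. Injectivity of \<open>\<phi>\<close> turns it into one for \<open>g\<close>, in which the power of \<open>\<phi>\<close> at \<open>s\<close> is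
  then removed by \<open>auto_pow_twisted_conj\<close>.\<close>

lemma twisted_closure_eq_vimage:
  assumes K: "K \<subseteq> carrier G"
  shows "{\<phi> (inv\<^bsub>G\<^esub> x) \<otimes>\<^bsub>G\<^esub> s \<otimes>\<^bsub>G\<^esub> x | x s. x \<in> carrier G \<and> s \<in> K} =
    {g \<in> carrier G. (0, g) \<otimes>\<^bsub>semidirect_int G \<phi>\<^esub> (1, \<one>\<^bsub>G\<^esub>) \<in>
      {inv\<^bsub>semidirect_int G \<phi>\<^esub> y \<otimes>\<^bsub>semidirect_int G \<phi>\<^esub> s \<otimes>\<^bsub>semidirect_int G \<phi>\<^esub> y | y s.
        y \<in> carrier (semidirect_int G \<phi>) \<and>
        s \<in> (\<lambda>x. x \<otimes>\<^bsub>semidirect_int G \<phi>\<^esub> (1, \<one>\<^bsub>G\<^esub>)) ` Pair 0 ` K}}"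
    (is "?L = ?R")
proof -
  have shift: "(0, g) \<otimes>\<^bsub>semidirect_int G \<phi>\<^esub> (1, \<one>\<^bsub>G\<^esub>) = (1, \<phi> g)" if "g \<in> carrier G" for g
    using that by (simp add: mult_semidirect pow_1 phi_closed)
  show ?thesis
  proof (intro equalityI subsetI)
    fix g assume "g \<in> ?L"
    then obtain x s where x: "x \<in> carrier G" and s: "s \<in> K"
      and g: "g = \<phi> (inv\<^bsub>G\<^esub> x) \<otimes>\<^bsub>G\<^esub> s \<otimes>\<^bsub>G\<^esub> x" by blast
    have sG: "s \<in> carrier G" using s K by auto
    have gG: "g \<in> carrier G" using g x sG by (simp add: phi_closed)
    have "(1, \<phi> g) = inv\<^bsub>semidirect_int G \<phi>\<^esub> (0, \<phi> x) \<otimes>\<^bsub>semidirect_int G \<phi>\<^esub> (1, \<phi> s)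
        \<otimes>\<^bsub>semidirect_int G \<phi>\<^esub> (0, \<phi> x)"
      using x sG by (simp add: g conj_semidirect phi_closed phi_mult phi_inv pow_0 pow_1)
    then show "g \<in> ?R"
      using gG sG s x shift by (force simp: carrier_semidirect phi_closed)
  next
    fix g assume "g \<in> ?R"
    then obtain n x s where g: "g \<in> carrier G" and x: "x \<in> carrier G" and s: "s \<in> K"
      and eq: "(0, g) \<otimes>\<^bsub>semidirect_int G \<phi>\<^esub> (1, \<one>\<^bsub>G\<^esub>) =
        inv\<^bsub>semidirect_int G \<phi>\<^esub> (n, x) \<otimes>\<^bsub>semidirect_int G \<phi>\<^esub>
        ((0, s) \<otimes>\<^bsub>semidirect_int G \<phi>\<^esub> (1, \<one>\<^bsub>G\<^esub>)) \<otimes>\<^bsub>semidirect_int G \<phi>\<^esub> (n, x)"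
      by (auto simp: carrier_semidirect)
    have sG: "s \<in> carrier G" using s K by auto
    obtain y where y: "y \<in> carrier G" "x = \<phi> y"
      using x aut by (auto simp: auto_def Bij_def bij_betw_def)
    have ns: "auto_pow n (\<phi> s) = \<phi> (auto_pow n s)"
      using pow_add[OF sG, of n 1] pow_add[OF sG, of 1 n] by (simp add: pow_1 add.commute)
    have "\<phi> g = \<phi> (inv\<^bsub>G\<^esub> x) \<otimes>\<^bsub>G\<^esub> auto_pow n (\<phi> s) \<otimes>\<^bsub>G\<^esub> x"
      using eq g x sG by (simp add: shift conj_semidirect phi_closed pow_1)
    also have "\<dots> = \<phi> (\<phi> (inv\<^bsub>G\<^esub> y) \<otimes>\<^bsub>G\<^esub> auto_pow n s \<otimes>\<^bsub>G\<^esub> y)"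
      using y sG by (simp add: ns phi_mult phi_inv phi_closed pow_closed)
    finally have \<phi>g: "\<phi> g = \<phi> (\<phi> (inv\<^bsub>G\<^esub> y) \<otimes>\<^bsub>G\<^esub> auto_pow n s \<otimes>\<^bsub>G\<^esub> y)" .
    have g_eq: "g = \<phi> (inv\<^bsub>G\<^esub> y) \<otimes>\<^bsub>G\<^esub> auto_pow n s \<otimes>\<^bsub>G\<^esub> y"
      by (rule phi_inj[OF g _ \<phi>g]) (simp add: y(1) sG phi_closed pow_closed)
    obtain z where z: "z \<in> carrier G" "auto_pow n s = \<phi> (inv\<^bsub>G\<^esub> z) \<otimes>\<^bsub>G\<^esub> s \<otimes>\<^bsub>G\<^esub> z"
      using auto_pow_twisted_conj[OF sG] by blast
    have "g = \<phi> (inv\<^bsub>G\<^esub> (z \<otimes>\<^bsub>G\<^esub> y)) \<otimes>\<^bsub>G\<^esub> s \<otimes>\<^bsub>G\<^esub> (z \<otimes>\<^bsub>G\<^esub> y)"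
      using z y sG by (simp add: g_eq G.inv_mult_group phi_mult phi_closed G.m_assoc)
    with z y s show "g \<in> ?L" by blast
  qed
qed

lemma finitely_generated_semidirect:
  assumes "finitely_presented G"
  shows "\<exists>B. finite_generating_set (semidirect_int G \<phi>) B"
proof -
  from assms obtain A :: "nat set" and R f where A: "finite A" and pres: "presents G A R f"
    by (auto simp: finitely_presented_def)
  have "\<exists>c. c \<in> words A \<and> word_val G f c = \<phi> (f a)" if "a \<in> A" for a
  proof -
    have "\<phi> (f a) \<in> word_val G f ` words A"
      using pres that phi_closed[of "f a"] by (auto simp: presents_def Pi_iff)
    then show ?thesis by auto
  qed
  then obtain c where "\<And>a. a \<in> A \<Longrightarrow> c a \<in> words A \<and> word_val G f (c a) = \<phi> (f a)"
    by metis
  from presents_semidirect_int[OF grp aut pres this]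
  have "finite_generating_set (semidirect_int G \<phi>) (semidirect_gen_val G f ` semidirect_gens A)"
    using A by (intro presents_imp_finite_generating_set[OF E.is_group])
      (auto simp: semidirect_gens_def)
  then show ?thesis by blast
qed

end

theorem theorem5p2:
  fixes G :: "('a, 'b) monoid_scheme" and \<K> :: subset_class
  assumes "group G"
    and "finitely_presented G"
    and "\<forall>\<phi>\<in>auto G. gen_conj_separable \<K> (semidirect_int G \<phi>)"
  shows "gen_twisted_conj_separable \<K> G \<and> gen_Brinkmann_conj_separable \<K> G"
proof -
  note G = assms(1)
  {
    fix K \<phi> assume aut: "\<phi> \<in> auto G" and K: "in_class \<K> G K"
    let ?E = "semidirect_int G \<phi>"
    let ?\<alpha> = "\<lambda>S. {inv\<^bsub>?E\<^esub> y \<otimes>\<^bsub>?E\<^esub> s \<otimes>\<^bsub>?E\<^esub> y | y s. y \<in> carrier ?E \<and> s \<in> S}"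
    let ?t = "(1 :: int, \<one>\<^bsub>G\<^esub>)"
    have E: "group ?E" by (rule group_semidirect_int[OF G aut])
    interpret E: group ?E by (rule E)
    note hom = embed_semidirect_hom[OF G aut]
    have t: "?t \<in> carrier ?E" using G by (simp add: carrier_semidirect[OF G aut] group.is_monoid)
    have KG: "K \<subseteq> carrier G" by (rule in_class_subset_carrier[OF G K])
    obtain B where B: "finite_generating_set ?E B"
      using finitely_generated_semidirect[OF G aut assms(2)] by blast
    have K0: "in_class \<K> ?E (Pair 0 ` K)"
      by (rule in_class_hom_image[OF G E hom B K])
    have sep: "separable ?E (?\<alpha> S)" if "in_class \<K> ?E S" for S
      using assms(3) aut that by (auto simp: gen_conj_separable_def)

    have "separable G {g \<in> carrier G. (0, g) \<otimes>\<^bsub>?E\<^esub> \<one>\<^bsub>?E\<^esub> \<in> ?\<alpha> (Pair 0 ` K)}"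
      by (rule separable_vimage_hom_mult[OF G E hom E.one_closed sep[OF K0]])
    moreover have "(0, g) \<otimes>\<^bsub>?E\<^esub> \<one>\<^bsub>?E\<^esub> = (0, g)" if "g \<in> carrier G" for g
      using that by (simp add: carrier_semidirect[OF G aut])
    ultimately have Brinkmann: "separable G
        {inv\<^bsub>G\<^esub> x \<otimes>\<^bsub>G\<^esub> (\<phi> [^]\<^bsub>AutoGroup G\<^esub> k) s \<otimes>\<^bsub>G\<^esub> x | x s (k :: int). x \<in> carrier G \<and> s \<in> K}"
      unfolding Brinkmann_closure_eq_vimage[OF G aut KG] by (simp cong: conj_cong)

    have twisted: "separable G {\<phi> (inv\<^bsub>G\<^esub> x) \<otimes>\<^bsub>G\<^esub> s \<otimes>\<^bsub>G\<^esub> x | x s. x \<in> carrier G \<and> s \<in> K}"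
      unfolding twisted_closure_eq_vimage[OF G aut KG]
      by (rule separable_vimage_hom_mult[OF G E hom t sep[OF in_class_mult_right[OF E t K0]]])
    note twisted Brinkmann
  }
  then show ?thesis
    unfolding gen_twisted_conj_separable_def gen_Brinkmann_conj_separable_def by blast
qed

end
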